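(* Let $f(x;w)$ be a ResNet or a DenseNet (as defined in the context), with all weights i.i.d. standard normal, evaluated at a fixed input $x$ with $\|x\|_2=1$. For every weight matrix $W^{\mathbf{k}}$ of the network, with $J^{\mathbf{k}}=\frac{\partial f(x;w)}{\partial W^{\mathbf{k}}}$ and $\|\cdot\|_2$ the Frobenius norm: 1. $\mathbb{E}_w\big[\|J^{\mathbf{k}}\|_2^2\big]=\mathbb{E}_w\big[(f_{(\mathbf{k})}(x;w))^2\big]$; 2. $\frac{1}{3}\mathbb{E}_w\big[(f_{(\mathbf{k})}(x;w))^4\big]\le\mathbb{E}_w\big[\|J^{\mathbf{k}}\|_2^4\big]\le\mathbb{E}_w\big[(f_{(\mathbf{k})}(x;w))^4\big]$.
   Context: $\phi(t)=\max(0,t)$ is the ReLU, applied coordinatewise. All weight entries are i.i.d. $\mathcal{N}(0,1)$. ResNet with residual branches of depth $m_b$: $f(x;w)=\frac{1}{\sqrt{n_L}}W^{L}y^L$ with final projection $W^{L}$ a row vector (distinct from the branch matrices $W^{L,h}$); $y^0=\frac{1}{\sqrt{n_0}}W^0x$; for $l\in[L]$, $y^l=y^{l-1}+\sqrt{\alpha_l}\,y^{l-1,m_b}$, where $y^{l-1,1}=\frac{1}{\sqrt{n_{l-1}}}W^{l,1}y^{l-1}$, $y^{l-1,h}=\frac{1}{\sqrt{n_{l-1,h-1}}}W^{l,h}q^{l-1,h-1}$ for $1<h\le m_b$, and $q^{l-1,h}=\sqrt2\,\phi(y^{l-1,h})$; $\alpha_l>0$, $n_{l-1,h}$ is the dimension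 of $y^{l-1,h}$, $n_l$ that of $y^l$, and dimensions are compatible (all $y^l$ have the same dimension). DenseNet: $f(x;w)=\frac{1}{\sqrt{n_L}}W^{L}y^L$ (final row-vector projection $W^L$); $y^0=\frac{1}{\sqrt{n_0}}W^0x$; for $l\in[L]$, $y^l=\sqrt{\frac{\alpha}{n_{l-1}\,l}}\sum_{h=0}^{l-1}W^{l,h}q^h$ with $q^h=\sqrt2\,\phi(y^h)$, $\alpha>0$, and $W^{l,h}$ having $n_l$ rows and as many columns as the dimension of $q^h$. Reduced network $f_{(\mathbf{k})}(x;w)$: the network obtained from $f$ by removing all connections bypassing $W^{\mathbf{k}}$ (same weights, recomputed activations). Concretely, for a ResNet and $\mathbf{k}=(l_k,h)$ a branch matrix, the recursion at layer $l_k$ becomes $y^{l_k}=\sqrt{\alpha_{l_k}}\,y^{l_k-1,m_b}$ (identity term dropped), all else unchanged; for a DenseNet and $\mathbf{k}=(l_k,h_k)$, $y^{l_k}=\sqrt{\frac{\alpha}{n_{l_k-1}l_k}}W^{l_k,h_k}q^{h_k}$ and for $l>l_k$, $y^l=\sqrt{\frac{\alpha}{n_{l-1}l}}\sum_{h=l_k}^{l-1}W^{l,h}q^h$; for the first and last projections $W^0,W^L$ nothing is removed. *)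

theory Defs
  imports "HOL-Probability.Probability"
begin

definition relu :: "real \<Rightarrow> real" where
  "relu t = max 0 t"

text \<open>Labels of the weight matrices.
  Win = W^0 (first projection), Wout = W^L (final row-vector projection),
  Wbr l h = W^{l,h} (ResNet branch matrix, resp. DenseNet matrix W^{l,h}).\<close>
datatype wlabel = Win | Wbr nat nat | Wout

text \<open>A weight configuration assigns a real number to each entry (k, i, j) =
  row i, column j of matrix W^k (rows and columns indexed from 0).\<close>
type_synonym weights = "wlabel \<times> nat \<times> nat \<Rightarrow> real"

definition std_normal :: "real measure" where
  "std_normal = density lborel std_normal_density"

definition weight_measure :: "(wlabel \<times> nat \<times> nat) set \<Rightarrow> weights measure" where
  "weight_measure E = PiM E (\<lambda>_. std_normal)"

definition entries :: "wlabel set \<Rightarrow> (wlabel \<Rightarrow> nat) \<Rightarrow> (wlabel \<Rightarrow> nat)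
    \<Rightarrow> (wlabel \<times> nat \<times> nat) set" where
  "entries K nr nc = {(k, i, j). k \<in> K \<and> i < nr k \<and> j < nc k}"

definition jac_fro_sq :: "(wlabel \<times> nat \<times> nat) set \<Rightarrow> (weights \<Rightarrow> real)
    \<Rightarrow> wlabel \<Rightarrow> weights \<Rightarrow> real" where
  "jac_fro_sq E F k w =
     (\<Sum>e\<in>{e \<in> E. fst e = k}. (deriv (\<lambda>t. F (w(e := t))) (w e))^2)"

text \<open>Architecture: input dimension d, L blocks, branch depth m (= m_b),
  common dimension n of all y^l, and nb l h = n_{l,h} the dimension of y^{l,h}
  for 0 < h < m.  The dimension of y^{l,0} := y^l and of y^{l,m} is n.\<close>
definition res_dim :: "nat \<Rightarrow> nat \<Rightarrow> (nat \<Rightarrow> nat \<Rightarrow> nat) \<Rightarrow> nat \<Rightarrow> nat \<Rightarrow> nat" where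
  "res_dim m n nb l h = (if h = 0 \<or> h = m then n else nb l h)"

text \<open>Branch of block l (paper's index l, 1 \<le> l \<le> L), fed with v = y^{l-1}:
  res_br ... l v h = y^{l-1,h} (with y^{l-1,0} = v).\<close>
primrec res_br :: "nat \<Rightarrow> nat \<Rightarrow> (nat \<Rightarrow> nat \<Rightarrow> nat) \<Rightarrow> weights \<Rightarrow> nat
    \<Rightarrow> (nat \<Rightarrow> real) \<Rightarrow> nat \<Rightarrow> (nat \<Rightarrow> real)" where
  "res_br m n nb w l v 0 = v"
| "res_br m n nb w l v (Suc h) =
     (\<lambda>i. (1 / sqrt (res_dim m n nb (l - 1) h)) *
        (\<Sum>j < res_dim m n nb (l - 1) h.
           w (Wbr l (Suc h), i, j) *
           (if h = 0 then v j else sqrt 2 * relu (res_br m n nb w l v h j))))"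

text \<open>Layers y^l.  The parameter red = Some l' means the identity (skip)
  term at layer l' is dropped (reduced network); None is the full network.\<close>
primrec res_y :: "nat \<Rightarrow> nat \<Rightarrow> nat \<Rightarrow> (nat \<Rightarrow> nat \<Rightarrow> nat) \<Rightarrow> (nat \<Rightarrow> real)
    \<Rightarrow> (nat \<Rightarrow> real) \<Rightarrow> nat option \<Rightarrow> weights \<Rightarrow> nat \<Rightarrow> (nat \<Rightarrow> real)" where
  "res_y d m n nb \<alpha> x red w 0 =
     (\<lambda>i. (1 / sqrt n) * (\<Sum>j<d. w (Win, i, j) * x j))"
| "res_y d m n nb \<alpha> x red w (Suc l) =
     (\<lambda>i. (if red = Some (Suc l) then 0 else res_y d m n nb \<alpha> x red w l i)
          + sqrt (\<alpha> (Suc l)) * res_br m n nb w (Suc l) (res_y d m n nb \<alpha> x red w l) m i)"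

definition resnet :: "nat \<Rightarrow> nat \<Rightarrow> nat \<Rightarrow> nat \<Rightarrow> (nat \<Rightarrow> nat \<Rightarrow> nat) \<Rightarrow> (nat \<Rightarrow> real)
    \<Rightarrow> (nat \<Rightarrow> real) \<Rightarrow> nat option \<Rightarrow> weights \<Rightarrow> real" where
  "resnet d L m n nb \<alpha> x red w =
     (1 / sqrt n) * (\<Sum>i<n. w (Wout, 0, i) * res_y d m n nb \<alpha> x red w L i)"

definition res_labels :: "nat \<Rightarrow> nat \<Rightarrow> wlabel set" where
  "res_labels L m = {Win, Wout} \<union> {Wbr l h | l h. 1 \<le> l \<and> l \<le> L \<and> 1 \<le> h \<and> h \<le> m}"

definition res_rows :: "nat \<Rightarrow> nat \<Rightarrow> (nat \<Rightarrow> nat \<Rightarrow> nat) \<Rightarrow> wlabel \<Rightarrow> nat" where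
  "res_rows m n nb k = (case k of Win \<Rightarrow> n | Wout \<Rightarrow> 1 | Wbr l h \<Rightarrow> res_dim m n nb (l - 1) h)"

definition res_cols :: "nat \<Rightarrow> nat \<Rightarrow> nat \<Rightarrow> (nat \<Rightarrow> nat \<Rightarrow> nat) \<Rightarrow> wlabel \<Rightarrow> nat" where
  "res_cols d m n nb k = (case k of Win \<Rightarrow> d | Wout \<Rightarrow> n | Wbr l h \<Rightarrow> res_dim m n nb (l - 1) (h - 1))"

definition res_entries :: "nat \<Rightarrow> nat \<Rightarrow> nat \<Rightarrow> nat \<Rightarrow> (nat \<Rightarrow> nat \<Rightarrow> nat)
    \<Rightarrow> (wlabel \<times> nat \<times> nat) set" where
  "res_entries d L m n nb = entries (res_labels L m) (res_rows m n nb) (res_cols d m n nb)"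

definition res_red :: "wlabel \<Rightarrow> nat option" where
  "res_red k = (case k of Wbr l h \<Rightarrow> Some l | _ \<Rightarrow> None)"

text \<open>Sources feeding layer l: all h < l for the full network (red = None);
  for the reduced network w.r.t. W^{lk,hk}: only hk at layer lk, and
  h \<in> {lk..<l} at layers l > lk.\<close>
definition dn_src :: "(nat \<times> nat) option \<Rightarrow> nat \<Rightarrow> nat set" where
  "dn_src red l = (case red of None \<Rightarrow> {..<l}
     | Some (lk, hk) \<Rightarrow> (if l = lk then {hk} else if lk < l then {lk..<l} else {..<l}))"

text \<open>dn_ys ... l h = y^h for h \<le> l; nw h = n_h is the dimension of y^h.\<close>
primrec dn_ys :: "nat \<Rightarrow> (nat \<Rightarrow> nat) \<Rightarrow> real \<Rightarrow> (nat \<Rightarrow> real) \<Rightarrow> (nat \<times> nat) option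
    \<Rightarrow> weights \<Rightarrow> nat \<Rightarrow> nat \<Rightarrow> (nat \<Rightarrow> real)" where
  "dn_ys d nw \<alpha> x red w 0 = (\<lambda>_ i. (1 / sqrt (nw 0)) * (\<Sum>j<d. w (Win, i, j) * x j))"
| "dn_ys d nw \<alpha> x red w (Suc l) =
     (dn_ys d nw \<alpha> x red w l)(Suc l :=
        (\<lambda>i. sqrt (\<alpha> / (nw l * Suc l)) *
           (\<Sum>h\<in>dn_src red (Suc l). \<Sum>j<nw h.
               w (Wbr (Suc l) h, i, j) * (sqrt 2 * relu (dn_ys d nw \<alpha> x red w l h j)))))"

definition densenet :: "nat \<Rightarrow> nat \<Rightarrow> (nat \<Rightarrow> nat) \<Rightarrow> real \<Rightarrow> (nat \<Rightarrow> real)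
    \<Rightarrow> (nat \<times> nat) option \<Rightarrow> weights \<Rightarrow> real" where
  "densenet d L nw \<alpha> x red w =
     (1 / sqrt (nw L)) * (\<Sum>i<nw L. w (Wout, 0, i) * dn_ys d nw \<alpha> x red w L L i)"

definition dn_labels :: "nat \<Rightarrow> wlabel set" where
  "dn_labels L = {Win, Wout} \<union> {Wbr l h | l h. 1 \<le> l \<and> l \<le> L \<and> h < l}"

definition dn_rows :: "(nat \<Rightarrow> nat) \<Rightarrow> wlabel \<Rightarrow> nat" where
  "dn_rows nw k = (case k of Win \<Rightarrow> nw 0 | Wout \<Rightarrow> 1 | Wbr l h \<Rightarrow> nw l)"

definition dn_cols :: "nat \<Rightarrow> nat \<Rightarrow> (nat \<Rightarrow> nat) \<Rightarrow> wlabel \<Rightarrow> nat" where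
  "dn_cols d L nw k = (case k of Win \<Rightarrow> d | Wout \<Rightarrow> nw L | Wbr l h \<Rightarrow> nw h)"

definition dn_entries :: "nat \<Rightarrow> nat \<Rightarrow> (nat \<Rightarrow> nat) \<Rightarrow> (wlabel \<times> nat \<times> nat) set" where
  "dn_entries d L nw = entries (dn_labels L) (dn_rows nw) (dn_cols d L nw)"

definition dn_red :: "wlabel \<Rightarrow> (nat \<times> nat) option" where
  "dn_red k = (case k of Wbr l h \<Rightarrow> Some (l, h) | _ \<Rightarrow> None)"

definition jacobian_moment_claims :: "(wlabel \<times> nat \<times> nat) set \<Rightarrow> (weights \<Rightarrow> real)
    \<Rightarrow> (weights \<Rightarrow> real) \<Rightarrow> wlabel \<Rightarrow> bool" where
  "jacobian_moment_claims E F Fk k \<longleftrightarrow>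
     (\<integral>w. jac_fro_sq E F k w \<partial>weight_measure E) = (\<integral>w. (Fk w)^2 \<partial>weight_measure E)
   \<and> (1/3) * (\<integral>w. (Fk w)^4 \<partial>weight_measure E) \<le> (\<integral>w. (jac_fro_sq E F k w)^2 \<partial>weight_measure E)
   \<and> (\<integral>w. (jac_fro_sq E F k w)^2 \<partial>weight_measure E) \<le> (\<integral>w. (Fk w)^4 \<partial>weight_measure E)"

end

theory Submission
  imports Defs
begin

text \<open>
  Let G be a Gaussian matrix of the shape of the matrix k, independent of the weights w. Given w, the
  directional derivative <J, G> is centred normal with variance |J|^2, so the second moment of
  <J, G> is that of |J|, and its fourth moment is three times that of |J|. It therefore suffices that
  <J, G> and the reduced network have the same law; the lower bound is then an equality.

  Both are outputs of the same recursion for a tangent vector started at k. They differ only in the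
  ReLU gates, which come from the preactivations V of the full network in <J, G>, and from the tangent u
  itself in the reduced network. Gates are exchanged one layer at a time, from the output
  downwards: negate all weights entering and leaving the units of the layer at which V and u have
  opposite signs. This leaves the later tangents unchanged, and it preserves the Gaussian measure,
  because V and u of the layer both change sign when the weights of a unit do, so that the
  decision whether to negate is invariant under negation.
\<close>

section \<open>Gaussian weights\<close>

text \<open>The order of the exchange is forced. ReLU is not odd, so flipping the units of a layer
  alters preactivations \<open>V\<close> above it; the tangents above survive the flip only because
  their gates have already been made to depend on the tangents alone. Only ReLU layers are flipped:
  they neither have nor feed a skip connection, so the sign of a unit is carried entirely by matrix
  entries. The obstacle is the value \<open>V = 0\<close>. Once a layer has died, units fed by it
  alone have preactivation exactly 0, and this has positive probability. There no invariant choice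
  of signs matches the gates, and ReLU has no derivative. \<open>good\<close> confines the value 0
  to units whose inputs all vanish. A ReLU unit of this kind reads only ReLU layers, since the
  linear layers read by ReLU units are \<open>robust\<close>; its tangent is then 0 as well, and it
  stays dead while one entry of k moves a little. Deleting the connections that bypass k costs
  nothing: they start at layers below the target of k, where the tangent is 0.\<close>

lemma sets_std_normal [measurable_cong, simp]: "sets std_normal = sets borel"
  by (simp add: std_normal_def)

lemma space_std_normal [simp]: "space std_normal = UNIV"
  by (simp add: std_normal_def)

lemma prob_space_std_normal: "prob_space std_normal"
  unfolding std_normal_def by (rule prob_space_normal_density) simp

lemma product_prob_space_std_normal: "product_prob_space (\<lambda>_::'i. std_normal)"
  by (intro product_prob_spaceI prob_space_std_normal)

lemma prob_space_weight_measure: "prob_space (weight_measure E)"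
  unfolding weight_measure_def by (rule prob_space_PiM) (rule prob_space_std_normal)

lemma sets_weight_measure [measurable_cong]:
  "sets (weight_measure E) = sets (PiM E (\<lambda>_. std_normal))"
  by (simp add: weight_measure_def)

lemma measurable_weight:
  "e \<in> E \<Longrightarrow> (\<lambda>w. w e) \<in> borel_measurable (weight_measure E)"
  unfolding weight_measure_def
  by (subst measurable_cong_sets[OF refl sets_std_normal[symmetric]])
     (rule measurable_component_singleton)

lemma emeasure_std_normal_sign:
  assumes "A \<in> sets borel" and "s = 1 \<or> s = (- 1 :: real)"
  shows "emeasure std_normal {x. s * x \<in> A} = emeasure std_normal A"
proof (cases "s = 1")
  case False
  then have s: "s = -1" using assms by auto
  have [measurable]: "A \<in> sets borel" by fact
  have A': "{x. - x \<in> A} \<in> sets borel"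
    using measurable_sets[of uminus borel borel A] assms by (simp add: vimage_def)
  have "emeasure std_normal {x. - x \<in> A}
      = (\<integral>\<^sup>+x. ennreal (std_normal_density (- x)) * indicator A (- x) \<partial>lborel)"
    unfolding std_normal_def using A'
    by (subst emeasure_density)
       (auto intro!: nn_integral_cong simp: normal_density_def split: split_indicator)
  also have "\<dots> = (\<integral>\<^sup>+x. ennreal (std_normal_density x) * indicator A x \<partial>distr lborel borel uminus)"
    by (subst nn_integral_distr) auto
  also have "\<dots> = emeasure std_normal A"
    unfolding lborel_distr_uminus std_normal_def using assms by (subst emeasure_density) auto
  finally show ?thesis by (simp add: s)
qed simp

lemma measurable_restrict_weights:
  assumes "\<And>e. e \<in> E \<Longrightarrow> (\<lambda>z. g z e) \<in> borel_measurable M"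
  shows "(\<lambda>z. restrict (g z) E) \<in> M \<rightarrow>\<^sub>M weight_measure E"
  unfolding weight_measure_def
  by (rule measurable_restrict) (use assms in \<open>simp add: measurable_cong_sets[OF refl sets_std_normal]\<close>)

text \<open>Symmetry of the standard normal, checked on measurable boxes, which determine the finite
  product measure.\<close>

lemma distr_flip_weights:
  assumes E: "finite E" and s: "\<And>e. e \<in> E \<Longrightarrow> s e = 1 \<or> s e = (- 1 :: real)"
  shows "distr (weight_measure E) (weight_measure E) (\<lambda>w. \<lambda>e\<in>E. s e * w e) = weight_measure E"
proof -
  interpret gauss: product_prob_space "\<lambda>_::wlabel \<times> nat \<times> nat. std_normal"
    by (rule product_prob_space_std_normal)
  let ?f = "\<lambda>w. \<lambda>e\<in>E. s e * w e"
  have f: "?f \<in> weight_measure E \<rightarrow>\<^sub>M weight_measure E"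
    by (intro measurable_restrict_weights borel_measurable_times measurable_weight) auto
  have "distr (weight_measure E) (weight_measure E) ?f = PiM E (\<lambda>_. std_normal)"
  proof (rule gauss.PiM_eqI[OF E])
    fix A assume A: "\<And>i. i \<in> E \<Longrightarrow> A i \<in> sets std_normal"
    have m: "{x. s i * x \<in> A i} \<in> sets std_normal" if "i \<in> E" for i
      using measurable_sets[of "\<lambda>x. s i * x" borel borel "A i"] A[OF that] by (simp add: vimage_def)
    have pre: "?f -` Pi\<^sub>E E A \<inter> space (weight_measure E) = Pi\<^sub>E E (\<lambda>i. {x. s i * x \<in> A i})"
      by (auto simp: weight_measure_def space_PiM PiE_iff)
    have "emeasure (distr (weight_measure E) (weight_measure E) ?f) (Pi\<^sub>E E A)
        = emeasure (weight_measure E) (Pi\<^sub>E E (\<lambda>i. {x. s i * x \<in> A i}))"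
      unfolding pre[symmetric] using f A
      by (intro emeasure_distr) (auto simp: weight_measure_def intro!: sets_PiM_I_finite E)
    also have "\<dots> = (\<Prod>i\<in>E. emeasure std_normal {x. s i * x \<in> A i})"
      unfolding weight_measure_def using m by (intro gauss.emeasure_PiM E) auto
    also have "\<dots> = (\<Prod>i\<in>E. emeasure std_normal (A i))"
      using A s by (intro prod.cong refl emeasure_std_normal_sign) auto
    finally show "emeasure (distr (weight_measure E) (weight_measure E) ?f) (Pi\<^sub>E E A) = \<dots>" .
  qed (simp add: weight_measure_def)
  then show ?thesis by (simp add: weight_measure_def)
qed

lemma measurable_mix_weights:
  "(\<lambda>(w, G). \<lambda>e\<in>E. if e \<in> K then G e else w e)
     \<in> weight_measure E \<Otimes>\<^sub>M weight_measure E \<rightarrow>\<^sub>M weight_measure E"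
proof -
  have 1: "(\<lambda>z. if e \<in> K then snd z e else fst z e)
      \<in> borel_measurable (weight_measure E \<Otimes>\<^sub>M weight_measure E)" if "e \<in> E" for e
    using measurable_compose[OF measurable_fst measurable_weight[OF that]]
      measurable_compose[OF measurable_snd measurable_weight[OF that]] by (cases "e \<in> K") auto
  show ?thesis
    using measurable_restrict_weights[OF 1] by (simp add: case_prod_unfold)
qed

text \<open>Resampling a block of independent coordinates does not change the law. With
  \<open>K\<close> a single entry this gives \<open>AE_weight_coordinate\<close>; with
  \<open>K\<close> the entries of the matrix k it merges the weights and the independent direction
  into one Gaussian configuration.\<close>

lemma distr_mix_weights:
  assumes E: "finite E"
  shows "distr (weight_measure E \<Otimes>\<^sub>M weight_measure E) (weight_measure E)
           (\<lambda>(w, G). \<lambda>e\<in>E. if e \<in> K then G e else w e) = weight_measure E"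
proof -
  interpret gauss: product_prob_space "\<lambda>_::wlabel \<times> nat \<times> nat. std_normal"
    by (rule product_prob_space_std_normal)
  let ?P = "weight_measure E"
  let ?f = "\<lambda>(w, G). \<lambda>e\<in>E. if e \<in> K then G e else w e"
  interpret P: prob_space ?P by (rule prob_space_weight_measure)
  have "distr (?P \<Otimes>\<^sub>M ?P) ?P ?f = PiM E (\<lambda>_. std_normal)"
  proof (rule gauss.PiM_eqI[OF E])
    fix A assume A: "\<And>i. i \<in> E \<Longrightarrow> A i \<in> sets std_normal"
    let ?B = "\<lambda>i. if i \<in> K then UNIV else A i" and ?C = "\<lambda>i. if i \<in> K then A i else UNIV"
    have BC: "Pi\<^sub>E E ?B \<in> sets ?P" "Pi\<^sub>E E ?C \<in> sets ?P"
      unfolding weight_measure_def using A by (auto intro!: sets_PiM_I_finite E)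
    have pre: "?f -` Pi\<^sub>E E A \<inter> space (?P \<Otimes>\<^sub>M ?P) = Pi\<^sub>E E ?B \<times> Pi\<^sub>E E ?C"
      by (auto simp: weight_measure_def space_pair_measure space_PiM PiE_iff split: if_splits)
    have "emeasure (distr (?P \<Otimes>\<^sub>M ?P) ?P ?f) (Pi\<^sub>E E A)
        = emeasure (?P \<Otimes>\<^sub>M ?P) (Pi\<^sub>E E ?B \<times> Pi\<^sub>E E ?C)"
      unfolding pre[symmetric] using A
      by (intro emeasure_distr measurable_mix_weights)
         (auto simp: weight_measure_def intro!: sets_PiM_I_finite E)
    also have "\<dots> = emeasure ?P (Pi\<^sub>E E ?B) * emeasure ?P (Pi\<^sub>E E ?C)"
      by (rule P.emeasure_pair_measure_Times[OF BC])
    also have "\<dots> = (\<Prod>i\<in>E. emeasure std_normal (?B i)) * (\<Prod>i\<in>E. emeasure std_normal (?C i))"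
      unfolding weight_measure_def using A by (subst (1 2) gauss.emeasure_PiM[OF E]) auto
    also have "\<dots> = (\<Prod>i\<in>E. emeasure std_normal (A i))"
      using prob_space.emeasure_space_1[OF prob_space_std_normal]
      unfolding prod.distrib[symmetric] by (intro prod.cong) auto
    finally show "emeasure (distr (?P \<Otimes>\<^sub>M ?P) ?P ?f) (Pi\<^sub>E E A) = \<dots>" .
  qed (simp add: weight_measure_def)
  then show ?thesis by (simp add: weight_measure_def)
qed

lemma AE_std_normal_neq: "AE \<theta> in std_normal. \<theta> \<noteq> a"
  unfolding std_normal_def by (subst AE_density) (auto intro: AE_mp[OF AE_lborel_singleton])

text \<open>Fubini in one coordinate: \<open>e\<close> is resampled from an independent copy, so for
  fixed \<open>w\<close> the condition concerns a single Gaussian real, and the resampled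
  configuration has the original law.\<close>

lemma AE_weight_coordinate:
  assumes E: "finite E" "e \<in> E"
    and Q: "{w \<in> space (weight_measure E). Q w} \<in> sets (weight_measure E)"
    and ae: "\<And>w. w \<in> space (weight_measure E) \<Longrightarrow> AE \<theta> in std_normal. Q (w(e := \<theta>))"
  shows "AE w in weight_measure E. Q w"
proof -
  let ?P = "weight_measure E"
  let ?f = "\<lambda>(w, G). \<lambda>e'\<in>E. if e' \<in> {e} then G e' else w e'"
  interpret P: prob_space ?P by (rule prob_space_weight_measure)
  interpret PP: pair_sigma_finite ?P ?P ..
  have eq: "?f (w, G) = w(e := G e)" if "w \<in> space ?P" for w G
    using that E(2) by (auto simp: weight_measure_def space_PiM PiE_def extensional_def)
  have "AE z in ?P \<Otimes>\<^sub>M ?P. Q (?f z)"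
  proof (rule PP.AE_pair_measure)
    show "{x \<in> space (?P \<Otimes>\<^sub>M ?P). Q (?f x)} \<in> sets (?P \<Otimes>\<^sub>M ?P)"
      using measurable_sets[OF measurable_mix_weights Q, of "{e}"]
        measurable_space[OF measurable_mix_weights, of _ E "{e}"]
      by (auto simp: vimage_def Int_def conj_commute elim!: back_subst[of "\<lambda>S. S \<in> sets _"])
    show "AE w in ?P. AE G in ?P. Q (?f (w, G))"
    proof (rule AE_I2)
      fix w assume w: "w \<in> space ?P"
      have "AE G in ?P. Q (w(e := G e))"
        unfolding weight_measure_def
        by (rule AE_PiM_component[OF prob_space_std_normal E(2) ae[OF w]])
      then show "AE G in ?P. Q (?f (w, G))"
        by (simp only: eq[OF w])
    qed
  qed
  then have "AE w in distr (?P \<Otimes>\<^sub>M ?P) ?P ?f. Q w"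
    by (subst AE_distr_iff[OF measurable_mix_weights Q])
  then show ?thesis by (simp only: distr_mix_weights[OF E(1)])
qed

text \<open>A map chosen by the point itself need not preserve the measure. Here it does: on each of
  the finitely many pieces where \<sigma> is constant, one measure-preserving map acts, and by
  \<open>inv\<close> the preimage of the piece under that map is the piece itself.\<close>

lemma nn_integral_select_preserving:
  assumes H: "finite H" and \<sigma>: "\<And>\<eta>. \<eta> \<in> H \<Longrightarrow> {z \<in> space M. \<sigma> z = \<eta>} \<in> sets M"
    and \<sigma>H: "\<And>z. z \<in> space M \<Longrightarrow> \<sigma> z \<in> H"
    and \<phi>: "\<And>\<eta>. \<eta> \<in> H \<Longrightarrow> \<phi> \<eta> \<in> M \<rightarrow>\<^sub>M M" "\<And>\<eta>. \<eta> \<in> H \<Longrightarrow> distr M M (\<phi> \<eta>) = M"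
    and inv: "\<And>\<eta> z. \<eta> \<in> H \<Longrightarrow> z \<in> space M \<Longrightarrow> \<sigma> (\<phi> \<eta> z) = \<sigma> z"
    and F: "F \<in> borel_measurable M"
  shows "(\<integral>\<^sup>+z. F (\<phi> (\<sigma> z) z) \<partial>M) = (\<integral>\<^sup>+z. F z \<partial>M)"
proof -
  let ?I = "\<lambda>\<eta>. indicator {z \<in> space M. \<sigma> z = \<eta>} :: _ \<Rightarrow> ennreal"
  have mI: "(\<lambda>z. F z * ?I \<eta> z) \<in> borel_measurable M" if "\<eta> \<in> H" for \<eta>
    using \<sigma>[OF that] F by measurable
  have mI': "(\<lambda>z. F (\<phi> \<eta> z) * ?I \<eta> z) \<in> borel_measurable M" if "\<eta> \<in> H" for \<eta>
    using \<sigma>[OF that] measurable_compose[OF \<phi>(1)[OF that] F] by measurable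
  have "(\<integral>\<^sup>+z. F (\<phi> (\<sigma> z) z) \<partial>M) = (\<integral>\<^sup>+z. (\<Sum>\<eta>\<in>H. F (\<phi> \<eta> z) * ?I \<eta> z) \<partial>M)"
    using \<sigma>H H by (intro nn_integral_cong)
      (auto simp: indicator_def sum.If_cases if_distrib[of "\<lambda>x. _ * x"] cong: if_cong)
  also have "\<dots> = (\<Sum>\<eta>\<in>H. \<integral>\<^sup>+z. F (\<phi> \<eta> z) * ?I \<eta> z \<partial>M)"
    using mI' by (intro nn_integral_sum)
  also have "\<dots> = (\<Sum>\<eta>\<in>H. \<integral>\<^sup>+z. F z * ?I \<eta> z \<partial>M)"
  proof (intro sum.cong refl)
    fix \<eta> assume \<eta>: "\<eta> \<in> H"
    have "(\<integral>\<^sup>+z. F (\<phi> \<eta> z) * ?I \<eta> z \<partial>M) = (\<integral>\<^sup>+z. F (\<phi> \<eta> z) * ?I \<eta> (\<phi> \<eta> z) \<partial>M)"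
      using inv[OF \<eta>] measurable_space[OF \<phi>(1)[OF \<eta>]]
      by (intro nn_integral_cong) (auto simp: indicator_def)
    also have "\<dots> = (\<integral>\<^sup>+z. F z * ?I \<eta> z \<partial>distr M M (\<phi> \<eta>))"
      by (intro nn_integral_distr[symmetric] \<phi>(1)[OF \<eta>])
         (use mI[OF \<eta>] in simp)
    finally show "(\<integral>\<^sup>+z. F (\<phi> \<eta> z) * ?I \<eta> z \<partial>M) = (\<integral>\<^sup>+z. F z * ?I \<eta> z \<partial>M)"
      by (simp only: \<phi>(2)[OF \<eta>])
  qed
  also have "\<dots> = (\<integral>\<^sup>+z. (\<Sum>\<eta>\<in>H. F z * ?I \<eta> z) \<partial>M)"
    using mI by (intro nn_integral_sum[symmetric])
  also have "\<dots> = (\<integral>\<^sup>+z. F z \<partial>M)"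
    using \<sigma>H H by (intro nn_integral_cong)
      (auto simp: indicator_def sum.If_cases if_distrib[of "\<lambda>x. _ * x"] cong: if_cong)
  finally show ?thesis .
qed

lemma gaussian_linear_form_moments:
  fixes D :: "wlabel \<times> nat \<times> nat \<Rightarrow> real"
  assumes E: "finite E" "S \<subseteq> E"
  shows "(\<integral>\<^sup>+G. ennreal ((\<Sum>e\<in>S. G e * D e)^2) \<partial>weight_measure E) = ennreal (\<Sum>e\<in>S. (D e)^2)"
    and "(\<integral>\<^sup>+G. ennreal ((\<Sum>e\<in>S. G e * D e)^4) \<partial>weight_measure E)
           = 3 * ennreal ((\<Sum>e\<in>S. (D e)^2)^2)"
proof -
  interpret gauss: product_prob_space "\<lambda>_::wlabel \<times> nat \<times> nat. std_normal"
    by (rule product_prob_space_std_normal)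
  let ?P = "weight_measure E"
  interpret P: prob_space ?P by (rule prob_space_weight_measure)
  note S = finite_subset[OF E(2,1)] E(2)
  \<comment> \<open>A zero coefficient gives a point mass, which has no normal density, so these
    terms are removed before the independent normals are added.\<close>
  define S' where "S' = {e \<in> S. D e \<noteq> 0}"
  have S': "finite S'" "S' \<subseteq> E" using S by (auto simp: S'_def)
  define v where "v = (\<Sum>e\<in>S. (D e)^2)"
  have v: "v = (\<Sum>e\<in>S'. (D e)^2)" unfolding v_def S'_def
    by (rule sum.mono_neutral_right) (use S in auto)
  have lin: "(\<Sum>e\<in>S. G e * D e) = (\<Sum>e\<in>S'. G e * D e)" for G
    unfolding S'_def by (rule sum.mono_neutral_right) (use S in auto)
  have "(\<integral>\<^sup>+G. ennreal ((\<Sum>e\<in>S. G e * D e)^2) \<partial>?P) = ennreal v \<and>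
        (\<integral>\<^sup>+G. ennreal ((\<Sum>e\<in>S. G e * D e)^4) \<partial>?P) = 3 * ennreal (v^2)"
  proof (cases "S' = {}")
    case True
    then show ?thesis by (simp add: lin v)
  next
    case False
    have vpos: "v > 0" unfolding v using False S' by (intro sum_pos) (auto simp: S'_def)
    have comp: "distr ?P borel (\<lambda>G. G e) = std_normal" if "e \<in> E" for e
      using distr_PiM_component[where M = "\<lambda>_. std_normal" and I = E and i = e] that prob_space_std_normal
      by (auto simp: weight_measure_def cong: distr_cong)
    have X: "distributed ?P lborel (\<lambda>G. G e) std_normal_density" if "e \<in> E" for e
      unfolding distributed_def using comp[OF that] measurable_weight[OF that]
      by (auto simp: std_normal_def cong: distr_cong)
    have Y: "distributed ?P lborel (\<lambda>G. G e * D e) (normal_density 0 \<bar>D e\<bar>)" if "e \<in> S'" for e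
      using P.normal_density_affine[OF X, of e "D e" 0] that S' by (auto simp: S'_def mult.commute)
    have ind: "P.indep_vars (\<lambda>_. borel) (\<lambda>e G. G e) S'"
    proof (subst P.indep_vars_iff_distr_eq_PiM'[OF False])
      have "distr ?P (PiM S' (\<lambda>_. std_normal)) (\<lambda>x. restrict x S') = PiM S' (\<lambda>_. std_normal)"
        unfolding weight_measure_def using gauss.distr_restrict[OF S'(2) E(1)] by simp
      moreover have "PiM S' (\<lambda>i. distr ?P borel (\<lambda>G. G i)) = PiM S' (\<lambda>_. std_normal)"
        by (rule PiM_cong) (use comp S'(2) in auto)
      ultimately show "distr ?P (PiM S' (\<lambda>_. borel)) (\<lambda>x. \<lambda>i\<in>S'. x i)
          = PiM S' (\<lambda>i. distr ?P borel (\<lambda>G. G i))"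
        by (simp cong: distr_cong sets_PiM_cong)
    qed (use S' measurable_weight in auto)
    have "P.indep_vars (\<lambda>_. borel) (\<lambda>e G. G e * D e) S'"
      using P.indep_vars_compose2[OF ind, of "\<lambda>e x. x * D e" "\<lambda>_. borel"] by simp
    from P.sum_indep_normal[OF S'(1) False this _ Y]
    have dist: "distributed ?P lborel (\<lambda>G. \<Sum>e\<in>S'. G e * D e) (normal_density 0 (sqrt v))"
      by (simp add: v S'_def)
    \<comment> \<open>The even moments of a centred normal of variance v: the value is v for
      \<open>k = 1\<close> and 3 v^2 for \<open>k = 2\<close>, the origin of the factor 3.\<close>
    have mom: "(\<integral>\<^sup>+G. ennreal ((\<Sum>e\<in>S. G e * D e)^(2*k)) \<partial>?P)
        = ennreal (fact (2 * k) / ((2 / v)^k * fact k))" for k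
    proof -
      have "(\<integral>\<^sup>+G. ennreal ((\<Sum>e\<in>S. G e * D e)^(2*k)) \<partial>?P)
          = (\<integral>\<^sup>+x. ennreal (normal_density 0 (sqrt v) x) * ennreal (x^(2*k)) \<partial>lborel)"
        unfolding lin using distributed_nn_integral[OF dist, of "\<lambda>x. ennreal (x^(2*k))"] by simp
      also have "\<dots> = (\<integral>\<^sup>+x. ennreal (normal_density 0 (sqrt v) x * (x - 0)^(2*k)) \<partial>lborel)"
        by (simp add: ennreal_mult')
      also have "\<dots> = ennreal (fact (2 * k) / ((2 / (sqrt v)\<^sup>2)^k * fact k))"
        using normal_moment_even[of "sqrt v" 0 k] vpos
        by (subst nn_integral_eq_integral) (auto simp: has_bochner_integral_iff)
      finally show ?thesis using vpos by simp
    qed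
    show ?thesis using mom[of 1] mom[of 2] vpos
      by (simp add: fact_numeral power2_eq_square ennreal_mult' ennreal_numeral[symmetric] del: ennreal_numeral)
  qed
  then show "(\<integral>\<^sup>+G. ennreal ((\<Sum>e\<in>S. G e * D e)^2) \<partial>weight_measure E) = ennreal (\<Sum>e\<in>S. (D e)^2)"
    and "(\<integral>\<^sup>+G. ennreal ((\<Sum>e\<in>S. G e * D e)^4) \<partial>weight_measure E)
           = 3 * ennreal ((\<Sum>e\<in>S. (D e)^2)^2)" by (simp_all add: v_def)
qed

section \<open>Layered ReLU networks\<close>

text \<open>The activation is applied when a layer is read: \<open>V\<close> stores preactivations,
  and \<open>r\<close> tells whether the readers of the layer see them through ReLU or
  linearly.\<close>

definition act :: "bool \<Rightarrow> real \<Rightarrow> real" where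
  "act r v = (if r then sqrt 2 * relu v else v)"

lemma measurable_act [measurable]: "act r \<in> borel_measurable borel"
  unfolding act_def relu_def by measurable

lemma act_eq_0_iff: "act r v = 0 \<longleftrightarrow> (if r then v \<le> 0 else v = 0)"
  by (auto simp: act_def relu_def)

text \<open>A common form of both architectures. Layer t reads each layer s in src t through its own matrix
  with label lab t s and coefficient c t s, and adds b t times the layer skip t (no skip connection if
  b t = 0). V gives the preactivations. The layers in robust are linear and almost surely nonzero;
  every other layer may die, that is, vanish with positive probability.\<close>

locale relu_network =
  fixes E :: "(wlabel \<times> nat \<times> nat) set"
    and Ls :: "'l set" and inp top :: 'l and robust :: "'l set"
    and rank :: "'l \<Rightarrow> nat" and N :: "'l \<Rightarrow> nat" and src :: "'l \<Rightarrow> 'l set"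
    and lab :: "'l \<Rightarrow> 'l \<Rightarrow> wlabel" and c :: "'l \<Rightarrow> 'l \<Rightarrow> real"
    and b :: "'l \<Rightarrow> real" and skip :: "'l \<Rightarrow> 'l" and isrelu :: "'l \<Rightarrow> bool"
    and x :: "nat \<Rightarrow> real" and V :: "weights \<Rightarrow> 'l \<Rightarrow> nat \<Rightarrow> real"
  assumes finite_E: "finite E" and finite_Ls: "finite Ls"
    and inp: "inp \<notin> Ls" "\<not> isrelu inp" "\<And>w j. V w inp j = x j" "\<exists>j<N inp. x j \<noteq> 0"
      "\<And>t. t \<in> Ls \<Longrightarrow> rank inp < rank t"
    and top: "top \<in> Ls" "\<not> isrelu top" "0 < N top" "\<And>t. t \<in> Ls \<Longrightarrow> t \<noteq> top \<Longrightarrow> rank t < rank top"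
    and rank_inj: "\<And>s t. s \<in> Ls \<Longrightarrow> t \<in> Ls \<Longrightarrow> rank s = rank t \<Longrightarrow> s = t"
    and finite_src: "\<And>t. t \<in> Ls \<Longrightarrow> finite (src t)"
    and src: "\<And>s t. t \<in> Ls \<Longrightarrow> s \<in> src t \<Longrightarrow> s \<in> insert inp Ls"
      "\<And>s t. t \<in> Ls \<Longrightarrow> s \<in> src t \<Longrightarrow> rank s < rank t"
      "\<And>s t. t \<in> Ls \<Longrightarrow> s \<in> src t \<Longrightarrow> c t s \<noteq> 0"
    and skip: "\<And>t. t \<in> Ls \<Longrightarrow> b t \<noteq> 0 \<Longrightarrow> skip t \<in> Ls"
      "\<And>t. t \<in> Ls \<Longrightarrow> b t \<noteq> 0 \<Longrightarrow> rank (skip t) < rank t"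
      "\<And>t. t \<in> Ls \<Longrightarrow> b t \<noteq> 0 \<Longrightarrow> N (skip t) = N t"
      "\<And>t. t \<in> Ls \<Longrightarrow> b t \<noteq> 0 \<Longrightarrow> \<not> isrelu (skip t)"
      "\<And>t. t \<in> Ls \<Longrightarrow> b t \<noteq> 0 \<Longrightarrow> \<not> isrelu t"
    and lab_inj: "\<And>t s t' s'. t \<in> Ls \<Longrightarrow> s \<in> src t \<Longrightarrow> t' \<in> Ls \<Longrightarrow> s' \<in> src t'
      \<Longrightarrow> lab t s = lab t' s' \<Longrightarrow> t = t' \<and> s = s'"
    and lab_E: "\<And>t s i j. t \<in> Ls \<Longrightarrow> s \<in> src t \<Longrightarrow> (lab t s, i, j) \<in> E \<longleftrightarrow> i < N t \<and> j < N s"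
    and V_eq: "\<And>w t i. t \<in> Ls \<Longrightarrow> i < N t \<Longrightarrow> V w t i = b t * V w (skip t) i
      + (\<Sum>s\<in>src t. c t s * (\<Sum>j<N s. w (lab t s, i, j) * act (isrelu s) (V w s j)))"
    and robust: "\<And>t s. t \<in> Ls \<Longrightarrow> isrelu t \<Longrightarrow> s \<in> src t \<Longrightarrow> isrelu s \<or> s \<in> robust"
      "\<And>t. t \<in> robust \<Longrightarrow> 0 < N t \<and> \<not> isrelu t"
      "\<And>t. t \<in> robust \<Longrightarrow> t = inp \<or> t \<in> Ls \<and> (b t \<noteq> 0 \<and> skip t \<in> robust \<or> robust \<inter> src t \<noteq> {})"
begin

abbreviation P :: "weights measure" where "P \<equiv> weight_measure E"

definition out :: "weights \<Rightarrow> 'l \<Rightarrow> nat \<Rightarrow> real" where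
  "out w t i = act (isrelu t) (V w t i)"

lemma V_rec: "t \<in> Ls \<Longrightarrow> i < N t \<Longrightarrow> V w t i = b t * V w (skip t) i
      + (\<Sum>s\<in>src t. c t s * (\<Sum>j<N s. w (lab t s, i, j) * out w s j))"
  using V_eq by (simp add: out_def)

lemma layer_induct [consumes 1, case_names base layer]:
  assumes "t \<in> insert inp Ls"
    and "Q inp"
    and "\<And>t. t \<in> Ls \<Longrightarrow> (\<And>s. s \<in> insert inp Ls \<Longrightarrow> rank s < rank t \<Longrightarrow> Q s) \<Longrightarrow> Q t"
  shows "Q t"
  using assms(1)
proof (induction t rule: measure_induct_rule[where f = rank])
  case (less t)
  then show ?case using assms(2,3) by (cases "t = inp") auto
qed

lemma V_local:
  assumes "t \<in> insert inp Ls" "i < N t"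
    and "\<And>t' s i j. t' \<in> Ls \<Longrightarrow> s \<in> src t' \<Longrightarrow> rank t' \<le> rank t \<Longrightarrow> i < N t' \<Longrightarrow> j < N s
      \<Longrightarrow> w (lab t' s, i, j) = w' (lab t' s, i, j)"
  shows "V w t i = V w' t i"
  using assms
proof (induction t arbitrary: i rule: layer_induct)
  case base
  then show ?case by (simp add: inp)
next
  case (layer t)
  have IH: "V w s j = V w' s j" if "s \<in> insert inp Ls" "rank s < rank t" "j < N s" for s j
    using that layer.prems(2) by (intro layer.IH) (auto intro: less_imp_le order.trans)
  have "b t * V w (skip t) i = b t * V w' (skip t) i"
    using IH[of "skip t" i] skip[OF layer.hyps] layer.prems(1) by (cases "b t = 0") auto
  moreover have "w (lab t s, i, j) * out w s j = w' (lab t s, i, j) * out w' s j"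
    if "s \<in> src t" "j < N s" for s j
    using layer.prems(2)[OF layer.hyps that(1) order.refl layer.prems(1) that(2)]
      IH[OF src(1,2)[OF layer.hyps that(1)] that(2)] by (simp add: out_def)
  ultimately show ?case
    using layer.prems(1) by (simp add: V_rec[OF layer.hyps])
qed

lemma measurable_weight_lab:
  assumes "t \<in> Ls" "s \<in> src t" "i < N t" "j < N s"
  shows "(\<lambda>w. w (lab t s, i, j)) \<in> borel_measurable P"
  by (rule measurable_weight) (simp add: assms lab_E)

lemma measurable_V: "t \<in> insert inp Ls \<Longrightarrow> i < N t \<Longrightarrow> (\<lambda>w. V w t i) \<in> borel_measurable P"
proof (induction t arbitrary: i rule: layer_induct)
  case base
  then show ?case by (simp add: inp)
next
  case (layer t)
  have 1: "(\<lambda>w. b t * V w (skip t) i) \<in> borel_measurable P"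
    using layer.IH[of "skip t" i] skip[OF layer.hyps] layer.prems by (cases "b t = 0") auto
  have 2: "(\<lambda>w. w (lab t s, i, j) * out w s j) \<in> borel_measurable P"
    if "s \<in> src t" "j < N s" for s j
    unfolding out_def
    using layer.IH[OF src(1,2)[OF layer.hyps that(1)] that(2)]
      measurable_weight_lab[OF layer.hyps that(1) layer.prems that(2)] by measurable
  show ?case
    unfolding V_rec[OF layer.hyps layer.prems]
    by (intro borel_measurable_add 1 borel_measurable_sum borel_measurable_times[OF borel_measurable_const] 2)
       auto
qed

lemma measurable_out: "t \<in> insert inp Ls \<Longrightarrow> i < N t \<Longrightarrow> (\<lambda>w. out w t i) \<in> borel_measurable P"
  unfolding out_def using measurable_V[of t i] by measurable

text \<open>Preactivations need not be nonzero almost surely, since whole layers may die with positive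
  probability; this is what remains true.\<close>

definition good :: "weights \<Rightarrow> bool" where
  "good w \<longleftrightarrow> (\<forall>t\<in>Ls. \<forall>s\<in>src t. \<forall>i<N t. \<forall>j<N s. out w s j \<noteq> 0 \<longrightarrow> V w t i \<noteq> 0)"

lemma out_update:
  assumes "t \<in> Ls" "s \<in> src t" "s' \<in> insert inp Ls" "rank s' < rank t" "j' < N s'"
  shows "V (w((lab t s, i, j) := \<theta>)) s' j' = V w s' j'"
    and "out (w((lab t s, i, j) := \<theta>)) s' j' = out w s' j'"
proof -
  show "V (w((lab t s, i, j) := \<theta>)) s' j' = V w s' j'"
  proof (rule V_local[OF assms(3,5)])
    fix t' s0 i0 j0 assume *: "t' \<in> Ls" "s0 \<in> src t'" "rank t' \<le> rank s'"
    then have "lab t' s0 \<noteq> lab t s" using lab_inj[OF *(1,2) assms(1,2)] assms(4) by auto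
    then show "(w((lab t s, i, j) := \<theta>)) (lab t' s0, i0, j0) = w (lab t' s0, i0, j0)"
      by simp
  qed
  then show "out (w((lab t s, i, j) := \<theta>)) s' j' = out w s' j'"
    by (simp add: out_def)
qed

text \<open>The sources and the skipped layer have lower rank and do not see this entry, so the
  preactivation is affine in it. The slope is nonzero as soon as the source unit is active, which is
  what \<open>AE_good\<close> exploits.\<close>

lemma V_update:
  assumes t: "t \<in> Ls" "s \<in> src t" and ij: "i < N t" "j < N s"
  shows "V (w((lab t s, i, j) := \<theta>)) t i
    = V w t i + (\<theta> - w (lab t s, i, j)) * (c t s * out w s j)"
proof -
  let ?e = "(lab t s, i, j)" let ?w = "w(?e := \<theta>)"
  have sk: "b t * V ?w (skip t) i = b t * V w (skip t) i"
    using skip[OF t(1)] out_update(1)[OF t, of "skip t" i] ij by (cases "b t = 0") auto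
  have "(\<Sum>j'<N s'. ?w (lab t s', i, j') * out ?w s' j')
      = (\<Sum>j'<N s'. w (lab t s', i, j') * out w s' j')
        + (if s' = s then (\<theta> - w ?e) * out w s j else 0)" if s': "s' \<in> src t" for s'
  proof (cases "s' = s")
    case False
    then have "lab t s' \<noteq> lab t s" using lab_inj[OF t(1) s' t] by auto
    then show ?thesis using False out_update[OF t src(1,2)[OF t(1) s']] by (auto intro!: sum.cong)
  next
    case True
    have "(\<Sum>j'<N s. ?w (lab t s, i, j') * out ?w s j')
        = (\<Sum>j'<N s. w (lab t s, i, j') * out w s j' + (if j' = j then (\<theta> - w ?e) * out w s j else 0))"
      using out_update[OF t src(1,2)[OF t]] by (intro sum.cong refl) (auto simp: algebra_simps)
    then show ?thesis using True ij by (simp add: sum.distrib)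
  qed
  then have "(\<Sum>s'\<in>src t. c t s' * (\<Sum>j'<N s'. ?w (lab t s', i, j') * out ?w s' j'))
      = (\<Sum>s'\<in>src t. c t s' * (\<Sum>j'<N s'. w (lab t s', i, j') * out w s' j')
          + (if s' = s then c t s * ((\<theta> - w ?e) * out w s j) else 0))"
    by (intro sum.cong refl) (simp add: algebra_simps)
  also have "\<dots> = (\<Sum>s'\<in>src t. c t s' * (\<Sum>j'<N s'. w (lab t s', i, j') * out w s' j'))
          + (\<theta> - w ?e) * (c t s * out w s j)"
    using t finite_src[OF t(1)] by (simp add: sum.distrib)
  finally show ?thesis
    using sk by (simp add: V_rec[OF t(1) ij(1)])
qed

lemma AE_good: "AE w in P. good w"
proof -
  have "AE w in P. out w s j \<noteq> 0 \<longrightarrow> V w t i \<noteq> 0"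
    if t: "t \<in> Ls" "s \<in> src t" and ij: "i < N t" "j < N s" for t s i j
  proof (rule AE_weight_coordinate[OF finite_E])
    let ?e = "(lab t s, i, j)"
    show "?e \<in> E" using lab_E t ij by auto
    have [measurable]: "(\<lambda>w. out w s j) \<in> borel_measurable P" "(\<lambda>w. V w t i) \<in> borel_measurable P"
      using measurable_out[OF src(1)[OF t] ij(2)] measurable_V[of t i] t ij by auto
    show "{w \<in> space P. out w s j \<noteq> 0 \<longrightarrow> V w t i \<noteq> 0} \<in> sets P"
      by measurable
    fix w
    show "AE \<theta> in std_normal. out (w(?e := \<theta>)) s j \<noteq> 0 \<longrightarrow> V (w(?e := \<theta>)) t i \<noteq> 0"
      \<comment> \<open>For an active source unit, the excluded value is the only zero of the affine
        function of \<theta> given by \<open>V_update\<close>.\<close>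
      using AE_std_normal_neq[of "w ?e - V w t i / (c t s * out w s j)"]
    proof eventually_elim
      case (elim \<theta>)
      show ?case
        unfolding V_update[OF t ij] out_update(2)[OF t src(1,2)[OF t] ij(2)]
        using elim src(3)[OF t] by (auto simp: field_simps)
    qed
  qed
  then have "AE w in P. \<forall>t\<in>Ls. \<forall>s\<in>src t. \<forall>i\<in>{..<N t}. \<forall>j\<in>{..<N s}.
      out w s j \<noteq> 0 \<longrightarrow> V w t i \<noteq> 0"
    by (intro AE_finite_allI finite_Ls finite_src finite_lessThan) auto
  then show ?thesis
    by eventually_elim (auto simp: good_def)
qed

text \<open>A robust layer has a robust source or a robust skipped layer. An active source makes all
  its units nonzero by \<open>good\<close>; if all sources are silent, none of them is robust, and
  the value is a nonzero multiple of the robust layer that is skipped to.\<close>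

lemma robust_nonzero:
  assumes "good w" "t \<in> insert inp Ls" "t \<in> robust"
  shows "\<exists>i<N t. out w t i \<noteq> 0"
proof -
  \<comment> \<open>Strengthened to all units, because a skip connection passes values on unit by
    unit.\<close>
  have "(\<exists>i<N t. out w t i \<noteq> 0) \<and> (t \<in> Ls \<longrightarrow> (\<forall>i<N t. V w t i \<noteq> 0))"
    using assms(2,3)
  proof (induction t rule: layer_induct)
    case base
    then show ?case using inp by (auto simp: out_def act_def)
  next
    case (layer t)
    have "V w t i \<noteq> 0" if i: "i < N t" for i
    proof (cases "\<exists>s\<in>src t. \<exists>j<N s. out w s j \<noteq> 0")
      case True
      then show ?thesis using assms(1) layer.hyps i unfolding good_def by blast
    next
      case False
      then have V: "V w t i = b t * V w (skip t) i"
        by (simp add: V_rec[OF layer.hyps i])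
      have "s \<notin> robust" if "s \<in> src t" for s
        using layer.IH[OF src(1,2)[OF layer.hyps that]] False that by auto
      then have "b t \<noteq> 0 \<and> skip t \<in> robust"
        using robust(3)[OF layer.prems] layer.hyps inp(1) by auto
      then show ?thesis
        using V layer.IH[of "skip t"] skip[OF layer.hyps] i by auto
    qed
    then show ?case
      using robust(2)[OF layer.prems] by (auto simp: out_def act_def)
  qed
  then show ?thesis by simp
qed

text \<open>\<open>good\<close> turns \<open>V = 0\<close> into silence of all inputs. A robust
  layer is never silent, so by the first property of \<open>robust\<close> every source is a ReLU
  layer.\<close>

lemma dead_unit:
  assumes "good w" "t \<in> Ls" "isrelu t" "i < N t" "V w t i = 0" "s \<in> src t"
  shows "isrelu s" "\<And>j. j < N s \<Longrightarrow> out w s j = 0"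
proof -
  show z: "\<And>j. j < N s \<Longrightarrow> out w s j = 0"
    using assms unfolding good_def by blast
  show "isrelu s"
    using robust(1)[OF assms(2,3,6)] robust_nonzero[OF assms(1) src(1)[OF assms(2,6)]] z by auto
qed

end

section \<open>Tangents and sign flips\<close>

locale relu_network_edge = relu_network E Ls inp top robust rank N src lab c b skip isrelu x V
  for E and Ls :: "'l set" and inp top robust rank N src lab c b skip isrelu x V +
  fixes tk sk :: 'l
  assumes tk: "tk \<in> Ls" "sk \<in> src tk"
begin

text \<open>For ranks below \<open>n\<close> a ReLU gate multiplies by the derivative of the
  activation at \<open>V\<close>, with value 0 chosen at the kink; from \<open>n\<close> on it is
  the activation of the tangent itself. One recursion thus covers both the derivative and a forward
  pass.\<close>

definition gate :: "nat \<Rightarrow> weights \<Rightarrow> 'l \<Rightarrow> nat \<Rightarrow> real \<Rightarrow> real" where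
  "gate n w s j p = (if \<not> isrelu s then p
     else if 0 < (if rank s < n then V w s j else p) then sqrt 2 * p else 0)"

text \<open>The tangent of the preactivations in direction G of the matrix read by tk from sk, except
  that only the layers of rank below n use the activation pattern of the network; the layers from
  rank n on use the signs of the tangent itself. So n = 0 gives the reduced network
  (with G in place of the matrix) and large n the directional derivative.\<close>

function hyb :: "nat \<Rightarrow> weights \<Rightarrow> weights \<Rightarrow> 'l \<Rightarrow> nat \<Rightarrow> real" where
  "hyb n w G t i = (if t \<in> Ls then
     (if b t = 0 then 0 else b t * hyb n w G (skip t) i)
     + (\<Sum>s\<in>src t. c t s * (\<Sum>j<N s. (if t = tk \<and> s = sk then G (lab t s, i, j) else 0) * out w s j
         + w (lab t s, i, j) * gate n w s j (hyb n w G s j))) else 0)"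
  by pat_completeness auto
termination
  by (relation "Wellfounded.measure (\<lambda>(n, w, G, t, i). rank t)") (auto simp: src skip)

declare hyb.simps [simp del]

lemma hyb_rec: "t \<in> Ls \<Longrightarrow> hyb n w G t i = b t * hyb n w G (skip t) i
     + (\<Sum>s\<in>src t. c t s * (\<Sum>j<N s. (if t = tk \<and> s = sk then G (lab t s, i, j) else 0) * out w s j
         + w (lab t s, i, j) * gate n w s j (hyb n w G s j)))"
  by (subst hyb.simps) simp

lemma gate_0 [simp]: "gate n w s j 0 = 0"
  by (simp add: gate_def)

lemma hyb_inp [simp]: "hyb n w G inp i = 0"
  by (subst hyb.simps) (simp add: inp)

lemma hyb_below: "t \<in> insert inp Ls \<Longrightarrow> rank t < rank tk \<Longrightarrow> hyb n w G t i = 0"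
proof (induction t arbitrary: i rule: layer_induct)
  case (layer t)
  have "hyb n w G s j = 0" if "s \<in> src t" for s j
    using layer src(1,2)[OF layer.hyps that] by auto
  moreover have "b t * hyb n w G (skip t) i = 0"
    using layer.IH[of "skip t"] layer.prems skip[OF layer.hyps] by (cases "b t = 0") auto
  moreover have "t \<noteq> tk" using layer.prems by auto
  ultimately show ?case
    by (auto simp: hyb_rec[OF layer.hyps])
qed simp

lemma measurable_gate:
  assumes "s \<in> insert inp Ls" "j < N s" "f \<in> M \<rightarrow>\<^sub>M P" "p \<in> borel_measurable M"
  shows "(\<lambda>z. gate n (f z) s j (p z)) \<in> borel_measurable M"
  using measurable_compose[OF assms(3) measurable_V[OF assms(1,2)]] assms(4)
  unfolding gate_def by measurable

text \<open>General in \<open>f\<close> and \<open>g\<close> to cover both an independent pair of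
  weights and direction and the diagonal, where the two coincide.\<close>

lemma measurable_hyb:
  assumes f: "f \<in> M \<rightarrow>\<^sub>M P" and g: "\<And>i j. i < N tk \<Longrightarrow> j < N sk \<Longrightarrow> (\<lambda>z. g z (lab tk sk, i, j)) \<in> borel_measurable M"
    and "t \<in> insert inp Ls" "i < N t"
  shows "(\<lambda>z. hyb n (f z) (g z) t i) \<in> borel_measurable M"
  using assms(3,4)
proof (induction t arbitrary: i rule: layer_induct)
  case (layer t)
  have 1: "(\<lambda>z. b t * hyb n (f z) (g z) (skip t) i) \<in> borel_measurable M"
    using layer.IH[of "skip t" i] skip[OF layer.hyps] layer.prems by (cases "b t = 0") auto
  have 2: "(\<lambda>z. f z (lab t s, i, j) * gate n (f z) s j (hyb n (f z) (g z) s j)) \<in> borel_measurable M"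
    if "s \<in> src t" "j < N s" for s j
    using measurable_compose[OF f measurable_weight_lab[OF layer.hyps that(1) layer.prems that(2)]]
      measurable_gate[OF src(1)[OF layer.hyps that(1)] that(2) f
        layer.IH[OF src(1,2)[OF layer.hyps that(1)] that(2)]]
    by (rule borel_measurable_times)
  have 3: "(\<lambda>z. (if t = tk \<and> s = sk then g z (lab t s, i, j) else 0) * out (f z) s j) \<in> borel_measurable M"
    if "s \<in> src t" "j < N s" for s j
    using g[of i j] layer.prems that
      measurable_compose[OF f measurable_out[OF src(1)[OF layer.hyps that(1)] that(2)]]
    by (cases "t = tk \<and> s = sk") auto
  show ?case
    unfolding hyb_rec[OF layer.hyps]
    by (intro borel_measurable_add 1 borel_measurable_sum borel_measurable_times[OF borel_measurable_const] 2 3)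
       auto
qed simp

text \<open>Raising the threshold changes only the gate through which a layer of rank
  \<open>n\<close> is read, and its readers have larger rank.\<close>

lemma hyb_Suc_lower: "t \<in> insert inp Ls \<Longrightarrow> rank t \<le> n \<Longrightarrow> hyb (Suc n) w G t i = hyb n w G t i"
proof (induction t arbitrary: i rule: layer_induct)
  case (layer t)
  have "gate (Suc n) w s j (hyb (Suc n) w G s j) = gate n w s j (hyb n w G s j)" if "s \<in> src t" for s j
    using layer src(1,2)[OF layer.hyps that] by (auto simp: gate_def)
  moreover have "b t * hyb (Suc n) w G (skip t) i = b t * hyb n w G (skip t) i"
    using layer.IH[of "skip t"] layer.prems skip[OF layer.hyps] by (cases "b t = 0") auto
  ultimately show ?case
    by (simp add: hyb_rec[OF layer.hyps])
qed simp

text \<open>Either no ReLU layer has rank \<open>n\<close>, so there is no gate to exchange, or that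
  layer lies below \<open>tk\<close> and its gate acts on a zero tangent.\<close>

lemma hyb_Suc_trivial:
  assumes "\<And>s. s \<in> Ls \<Longrightarrow> isrelu s \<Longrightarrow> rank s = n \<Longrightarrow> n < rank tk"
  shows "t \<in> insert inp Ls \<Longrightarrow> hyb (Suc n) w G t i = hyb n w G t i"
proof (induction t arbitrary: i rule: layer_induct)
  case (layer t)
  have "gate (Suc n) w s j (hyb (Suc n) w G s j) = gate n w s j (hyb n w G s j)" if "s \<in> src t" for s j
  proof (cases "isrelu s \<and> rank s = n")
    case True
    then have "s \<in> Ls" using src(1)[OF layer.hyps that] inp by auto
    then have "hyb n w G s j = 0" using True assms[of s] by (intro hyb_below) auto
    then show ?thesis using layer.IH src(1,2)[OF layer.hyps that] by auto
  next
    case False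
    then show ?thesis using layer.IH src(1,2)[OF layer.hyps that] by (auto simp: gate_def)
  qed
  moreover have "b t * hyb (Suc n) w G (skip t) i = b t * hyb n w G (skip t) i"
    using layer.IH[of "skip t"] layer.prems skip[OF layer.hyps] by (cases "b t = 0") auto
  ultimately show ?case
    by (simp add: hyb_rec[OF layer.hyps])
qed simp

text \<open>All sources are silent ReLU layers. The direct term contains their outputs, which are 0;
  their ranks are below \<open>n\<close>, so their gates follow \<open>V\<close> and are
  closed.\<close>

lemma hyb_dead:
  assumes "good w" "t \<in> Ls" "isrelu t" "i < N t" "V w t i = 0" "rank t \<le> n"
  shows "hyb n w G t i = 0"
proof -
  have "out w s j = 0" "gate n w s j (hyb n w G s j) = 0" if "s \<in> src t" "j < N s" for s j
  proof -
    show z: "out w s j = 0" using dead_unit(2)[OF assms(1-5) that] .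
    then have "V w s j \<le> 0" using dead_unit(1)[OF assms(1-5) that(1)]
      by (simp add: out_def act_eq_0_iff)
    then show "gate n w s j (hyb n w G s j) = 0"
      using dead_unit(1)[OF assms(1-5) that(1)] src(2)[OF assms(2) that(1)] assms(6)
      by (simp add: gate_def)
  qed
  then show ?thesis
    using skip(5)[OF assms(2)] assms(3) by (auto simp: hyb_rec[OF assms(2)])
qed

text \<open>The factor \<open>d\<close> is 1 for layers whose tangent is to be unchanged, and the
  sign of the unit on the flipped layer.\<close>

lemma hyb_eqI:
  assumes "t \<in> Ls"
    and "b t \<noteq> 0 \<Longrightarrow> hyb n w G (skip t) i = d * hyb n' w' G' (skip t) i"
    and "\<And>s j. s \<in> src t \<Longrightarrow> j < N s \<Longrightarrow>
      (if t = tk \<and> s = sk then G (lab t s, i, j) else 0) * out w s j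
         + w (lab t s, i, j) * gate n w s j (hyb n w G s j)
      = d * ((if t = tk \<and> s = sk then G' (lab t s, i, j) else 0) * out w' s j
         + w' (lab t s, i, j) * gate n' w' s j (hyb n' w' G' s j))"
  shows "hyb n w G t i = d * hyb n' w' G' t i"
proof -
  have "b t * hyb n w G (skip t) i = d * (b t * hyb n' w' G' (skip t) i)"
    using assms(2) by (cases "b t = 0") auto
  moreover have "(\<Sum>s\<in>src t. c t s * (\<Sum>j<N s. (if t = tk \<and> s = sk then G (lab t s, i, j) else 0) * out w s j
         + w (lab t s, i, j) * gate n w s j (hyb n w G s j)))
     = (\<Sum>s\<in>src t. c t s * (\<Sum>j<N s. d * ((if t = tk \<and> s = sk then G' (lab t s, i, j) else 0) * out w' s j
         + w' (lab t s, i, j) * gate n' w' s j (hyb n' w' G' s j))))"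
    using assms(3) by (intro sum.cong refl arg_cong[where f = "(*) _"]) auto
  ultimately show ?thesis
    unfolding hyb_rec[OF assms(1)] by (simp add: sum_distrib_left distrib_left mult.left_commute)
qed

text \<open>A unit of \<tau> owns a row of each matrix entering \<tau> and a column of each matrix
  leaving it, hence the signs at \<open>i\<close> and at \<open>j\<close>.\<close>

definition flip_sign :: "'l \<Rightarrow> (nat \<Rightarrow> real) \<Rightarrow> wlabel \<times> nat \<times> nat \<Rightarrow> real" where
  "flip_sign \<tau> \<eta> = (\<lambda>(k, i, j). (if \<exists>s\<in>src \<tau>. k = lab \<tau> s then \<eta> i else 1)
     * (if \<exists>t\<in>Ls. \<tau> \<in> src t \<and> k = lab t \<tau> then \<eta> j else 1))"

text \<open>The restriction to \<open>E\<close> keeps the result in the space of extensional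
  functions that carries \<open>weight_measure\<close>.\<close>

definition flip :: "'l \<Rightarrow> (nat \<Rightarrow> real) \<Rightarrow> weights \<Rightarrow> weights" where
  "flip \<tau> \<eta> w = (\<lambda>e\<in>E. flip_sign \<tau> \<eta> e * w e)"

lemma flip_apply:
  assumes "\<tau> \<in> Ls" "t \<in> Ls" "s \<in> src t" "i < N t" "j < N s"
  shows "flip \<tau> \<eta> w (lab t s, i, j)
    = (if t = \<tau> then \<eta> i else 1) * (if s = \<tau> then \<eta> j else 1) * w (lab t s, i, j)"
proof -
  have "(\<exists>s'\<in>src \<tau>. lab t s = lab \<tau> s') \<longleftrightarrow> t = \<tau>"
    using assms lab_inj[OF assms(2,3,1)] by blast
  moreover have "(\<exists>t'\<in>Ls. \<tau> \<in> src t' \<and> lab t s = lab t' \<tau>) \<longleftrightarrow> s = \<tau>"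
    using assms lab_inj[OF assms(2,3)] by blast
  ultimately show ?thesis
    using assms by (simp add: flip_def flip_sign_def lab_E)
qed

context
  fixes \<tau> :: 'l and \<eta> :: "nat \<Rightarrow> real"
  assumes \<tau>: "\<tau> \<in> Ls" "isrelu \<tau>"
begin

lemma V_flip_lower:
  "t \<in> insert inp Ls \<Longrightarrow> rank t < rank \<tau> \<Longrightarrow> i < N t \<Longrightarrow> V (flip \<tau> \<eta> w) t i = V w t i"
proof (rule V_local)
  fix t' s i' j assume *: "rank t < rank \<tau>" "t' \<in> Ls" "s \<in> src t'" "rank t' \<le> rank t" "i' < N t'" "j < N s"
  then have "t' \<noteq> \<tau>" "s \<noteq> \<tau>" using src(2)[OF *(2,3)] by auto
  then show "flip \<tau> \<eta> w (lab t' s, i', j) = w (lab t' s, i', j)"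
    using flip_apply[OF \<tau>(1) *(2,3,5,6)] by simp
qed

lemma out_flip_lower:
  "t \<in> insert inp Ls \<Longrightarrow> rank t < rank \<tau> \<Longrightarrow> i < N t \<Longrightarrow> out (flip \<tau> \<eta> w) t i = out w t i"
  using V_flip_lower by (simp add: out_def)

lemma b_relu: "b \<tau> = 0"
  using skip(5)[OF \<tau>(1)] \<tau>(2) by auto

lemma flip_in: "s \<in> src \<tau> \<Longrightarrow> i < N \<tau> \<Longrightarrow> j < N s \<Longrightarrow> flip \<tau> \<eta> w (lab \<tau> s, i, j) = \<eta> i * w (lab \<tau> s, i, j)"
  using flip_apply[OF \<tau>(1) \<tau>(1), of s i j] src(2)[OF \<tau>(1), of s] by auto

lemma V_flip_same:
  assumes "i < N \<tau>"
  shows "V (flip \<tau> \<eta> w) \<tau> i = \<eta> i * V w \<tau> i"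
proof -
  have "(\<Sum>j<N s. flip \<tau> \<eta> w (lab \<tau> s, i, j) * out (flip \<tau> \<eta> w) s j)
      = \<eta> i * (\<Sum>j<N s. w (lab \<tau> s, i, j) * out w s j)" if "s \<in> src \<tau>" for s
    unfolding sum_distrib_left using that assms src(1,2)[OF \<tau>(1) that]
    by (intro sum.cong refl) (simp add: flip_in out_flip_lower)
  then have "(\<Sum>s\<in>src \<tau>. c \<tau> s * (\<Sum>j<N s. flip \<tau> \<eta> w (lab \<tau> s, i, j) * out (flip \<tau> \<eta> w) s j))
      = (\<Sum>s\<in>src \<tau>. \<eta> i * (c \<tau> s * (\<Sum>j<N s. w (lab \<tau> s, i, j) * out w s j)))"
    by (intro sum.cong refl) simp
  then show ?thesis
    by (simp add: V_rec[OF \<tau>(1) assms] b_relu sum_distrib_left)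
qed

lemma gate_flip_lower:
  "s \<in> insert inp Ls \<Longrightarrow> rank s < rank \<tau> \<Longrightarrow> j < N s \<Longrightarrow> gate n (flip \<tau> \<eta> w) s j p = gate n w s j p"
  using V_flip_lower by (simp add: gate_def)

lemma hyb_flip_lower:
  "t \<in> insert inp Ls \<Longrightarrow> rank t < rank \<tau> \<Longrightarrow> i < N t
    \<Longrightarrow> hyb n (flip \<tau> \<eta> w) (flip \<tau> \<eta> G) t i = hyb n w G t i"
proof (induction t arbitrary: i rule: layer_induct)
  case (layer t)
  have "hyb n (flip \<tau> \<eta> w) (flip \<tau> \<eta> G) t i = 1 * hyb n w G t i"
  proof (rule hyb_eqI[OF layer.hyps])
    show "b t \<noteq> 0 \<Longrightarrow> hyb n (flip \<tau> \<eta> w) (flip \<tau> \<eta> G) (skip t) i = 1 * hyb n w G (skip t) i"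
      using layer.IH[of "skip t" i] skip[OF layer.hyps] layer.prems by auto
    fix s j assume s: "s \<in> src t" "j < N s"
    have r: "rank s < rank t" "rank s < rank \<tau>" using src(2)[OF layer.hyps s(1)] layer.prems by auto
    have fl: "flip \<tau> \<eta> w' (lab t s, i, j) = w' (lab t s, i, j)" for w'
      using flip_apply[OF \<tau>(1) layer.hyps s(1) layer.prems(2) s(2), of \<eta> w'] layer.prems(1) r by auto
    show "(if t = tk \<and> s = sk then flip \<tau> \<eta> G (lab t s, i, j) else 0) * out (flip \<tau> \<eta> w) s j
          + flip \<tau> \<eta> w (lab t s, i, j) * gate n (flip \<tau> \<eta> w) s j (hyb n (flip \<tau> \<eta> w) (flip \<tau> \<eta> G) s j)
        = 1 * ((if t = tk \<and> s = sk then G (lab t s, i, j) else 0) * out w s j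
          + w (lab t s, i, j) * gate n w s j (hyb n w G s j))"
      unfolding fl using layer.IH[OF src(1)[OF layer.hyps s(1)] r s(2)] src(1)[OF layer.hyps s(1)] r s
      by (simp add: out_flip_lower gate_flip_lower)
  qed
  then show ?case by simp
qed simp

text \<open>With \<open>V_flip_same\<close> this makes the product of \<open>V\<close> and the
  tangent invariant under flips. The direction must be flipped along with the weights: if \<tau> is
  \<open>tk\<close>, the tangent enters through \<open>G\<close>, while \<open>V\<close> enters
  through \<open>w\<close>.\<close>

lemma hyb_flip_same:
  assumes i: "i < N \<tau>"
  shows "hyb n (flip \<tau> \<eta> w) (flip \<tau> \<eta> G) \<tau> i = \<eta> i * hyb n w G \<tau> i"
proof (rule hyb_eqI[OF \<tau>(1)])
  fix s j assume s: "s \<in> src \<tau>" "j < N s"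
  note r = src(1,2)[OF \<tau>(1) s(1)]
  show "(if \<tau> = tk \<and> s = sk then flip \<tau> \<eta> G (lab \<tau> s, i, j) else 0) * out (flip \<tau> \<eta> w) s j
          + flip \<tau> \<eta> w (lab \<tau> s, i, j) * gate n (flip \<tau> \<eta> w) s j (hyb n (flip \<tau> \<eta> w) (flip \<tau> \<eta> G) s j)
        = \<eta> i * ((if \<tau> = tk \<and> s = sk then G (lab \<tau> s, i, j) else 0) * out w s j
          + w (lab \<tau> s, i, j) * gate n w s j (hyb n w G s j))"
    unfolding flip_in[OF s(1) i s(2)]
    using r s i by (simp add: out_flip_lower gate_flip_lower hyb_flip_lower distrib_left)
qed (simp add: b_relu)

end

text \<open>Only the product is consulted, so that the choice is invariant under flips; a zero
  product counts as agreement. The restriction to the units makes it range over a finite set, as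
  \<open>nn_integral_select_preserving\<close> requires.\<close>

definition flip_choice :: "nat \<Rightarrow> 'l \<Rightarrow> weights \<times> weights \<Rightarrow> nat \<Rightarrow> real" where
  "flip_choice n \<tau> = (\<lambda>(w, G). \<lambda>i\<in>{..<N \<tau>}. if V w \<tau> i * hyb n w G \<tau> i < 0 then - 1 else 1)"

text \<open>The heart of the exchange. After the flip a nonzero tangent at a unit of \<tau> has the
  sign of \<open>V\<close>, so its own gate is open exactly when the gate of the network is. Where
  it is open, the sign of the tangent and the sign of the outgoing entry cancel.\<close>

lemma hyb_flip_choice:
  fixes G :: weights
  assumes \<tau>: "\<tau> \<in> Ls" "isrelu \<tau>" "rank \<tau> = n" "rank tk \<le> n" and good: "good w"
  defines "\<eta> \<equiv> flip_choice n \<tau> (w, G)"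
  shows "t \<in> insert inp Ls \<Longrightarrow> n < rank t \<Longrightarrow> i < N t
    \<Longrightarrow> hyb n (flip \<tau> \<eta> w) (flip \<tau> \<eta> G) t i = hyb (Suc n) w G t i"
proof (induction t arbitrary: i rule: layer_induct)
  case (layer t)
  let ?w = "flip \<tau> \<eta> w" and ?G = "flip \<tau> \<eta> G"
  have tt: "t \<noteq> tk" "t \<noteq> \<tau>" using layer.prems \<tau> by auto
  have lower: "hyb n ?w ?G s j = hyb (Suc n) w G s j" if "s \<in> insert inp Ls" "rank s < n" "j < N s" for s j
    using that \<tau> by (simp add: hyb_flip_lower hyb_Suc_lower)
  have "hyb n ?w ?G t i = 1 * hyb (Suc n) w G t i"
  proof (rule hyb_eqI[OF layer.hyps])
    assume b: "b t \<noteq> 0"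
    note sk = skip[OF layer.hyps b]
    \<comment> \<open>Skipped layers are linear, so none of them is the flipped layer.\<close>
    have "rank (skip t) \<noteq> n" using rank_inj[OF sk(1) \<tau>(1)] sk(4) \<tau>(2,3) by auto
    then show "hyb n ?w ?G (skip t) i = 1 * hyb (Suc n) w G (skip t) i"
      using lower[of "skip t" i] layer.IH[of "skip t" i] sk layer.prems by (cases "rank (skip t) < n") auto
  next
    fix s j assume s: "s \<in> src t" "j < N s"
    note r = src(1,2)[OF layer.hyps s(1)]
    have fl: "?w (lab t s, i, j) = (if s = \<tau> then \<eta> j else 1) * w (lab t s, i, j)"
      using flip_apply[OF \<tau>(1) layer.hyps s(1) layer.prems(2) s(2), of \<eta> w] tt by simp
    have "?w (lab t s, i, j) * gate n ?w s j (hyb n ?w ?G s j)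
        = w (lab t s, i, j) * gate (Suc n) w s j (hyb (Suc n) w G s j)"
    proof (cases "s = \<tau>")
      case True
      let ?p = "hyb n w G \<tau> j"
      have p: "hyb (Suc n) w G \<tau> j = ?p" using \<tau> by (simp add: hyb_Suc_lower)
      have p': "hyb n ?w ?G \<tau> j = \<eta> j * ?p"
        using hyb_flip_same[OF \<tau>(1,2)] s True by auto
      have \<eta>: "\<eta> j = (if V w \<tau> j * ?p < 0 then - 1 else 1)"
        using s True by (simp add: \<eta>_def flip_choice_def)
      \<comment> \<open>At \<open>V = 0\<close> the gate of the network is closed, while the chosen
        sign is 1 and a positive tangent would open its own gate; so the tangent has to
        vanish.\<close>
      have "V w \<tau> j = 0 \<Longrightarrow> ?p = 0"
        using hyb_dead[OF good \<tau>(1,2)] s True \<tau>(3) by auto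
      then have "\<eta> j * gate n ?w \<tau> j (\<eta> j * ?p) = gate (Suc n) w \<tau> j ?p"
        using \<tau>(2,3) unfolding gate_def \<eta>
        by (auto simp: mult_less_0_iff not_less zero_less_mult_iff)
      then show ?thesis using fl by (simp add: True p p')
    next
      case False
      then have fl: "?w (lab t s, i, j) = w (lab t s, i, j)" using fl by simp
      show ?thesis
      proof (cases "rank s < n")
        case True
        then show ?thesis
          using lower[OF r(1) True s(2)] gate_flip_lower[OF \<tau>(1,2) r(1) _ s(2), of n \<eta> w] \<tau>(3)
          by (simp add: fl) (simp add: gate_def)
      next
        case F: False
        show ?thesis
        proof (cases "n < rank s")
          case True
          \<comment> \<open>Both hybrids read layers above \<open>n\<close> by the sign of the
            tangent, so the change of \<open>V\<close> there is harmless.\<close>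
          then show ?thesis using layer.IH[OF r True s(2)] by (simp add: fl gate_def)
        next
          case False
          then have rs: "rank s = n" using F by simp
          show ?thesis
          proof (cases "s = inp")
            case False
            then show ?thesis using rank_inj[of s \<tau>] r rs \<tau> \<open>s \<noteq> \<tau>\<close> by auto
          qed simp
        qed
      qed
    qed
    then show "(if t = tk \<and> s = sk then ?G (lab t s, i, j) else 0) * out ?w s j
          + ?w (lab t s, i, j) * gate n ?w s j (hyb n ?w ?G s j)
        = 1 * ((if t = tk \<and> s = sk then G (lab t s, i, j) else 0) * out w s j
          + w (lab t s, i, j) * gate (Suc n) w s j (hyb (Suc n) w G s j))"
      using tt by simp
  qed
  then show ?case by simp
qed simp

end

section \<open>One-sided derivatives and measurability of \<open>deriv\<close>\<close>

lemma deriv_from_one_sided: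
  fixes f :: "real \<Rightarrow> real"
  assumes "(f has_real_derivative R) (at_right x)" "(f has_real_derivative L) (at_left x)"
  shows "deriv f x = (if L = R then R else (SOME D. False))"
proof (cases "L = R")
  case True
  then have "(f has_real_derivative R) (at x)"
    using assms by (simp add: has_field_derivative_iff filterlim_at_split)
  then show ?thesis using True by (simp add: DERIV_imp_deriv)
next
  case False
  have "\<not> (f has_real_derivative D) (at x)" for D
  proof
    assume "(f has_real_derivative D) (at x)"
    then have D: "(f has_real_derivative D) (at_right x)" "(f has_real_derivative D) (at_left x)"
      by (auto intro: has_field_derivative_at_within)
    have "D = R" "D = L"
      using tendsto_unique[OF trivial_limit_at_right_real[of x]] tendsto_unique[OF trivial_limit_at_left_real[of x]]
        D assms unfolding has_field_derivative_iff by blast+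
    then show False using False by simp
  qed
  then show ?thesis using False by (simp add: deriv_def)
qed

text \<open>Also where the derivative does not exist, since \<^const>\<open>deriv\<close> then has a fixed junk value.\<close>

lemma measurable_deriv_of_one_sided:
  fixes g :: "'a \<Rightarrow> real \<Rightarrow> real"
  assumes g: "\<And>q. (\<lambda>z. g z (a z + q)) \<in> borel_measurable M"
    and R: "\<And>z. z \<in> space M \<Longrightarrow> \<exists>D. (g z has_real_derivative D) (at_right (a z))"
    and L: "\<And>z. z \<in> space M \<Longrightarrow> \<exists>D. (g z has_real_derivative D) (at_left (a z))"
  shows "(\<lambda>z. deriv (g z) (a z)) \<in> borel_measurable M"
proof -
  have g0: "(\<lambda>z. g z (a z)) \<in> borel_measurable M" using g[of 0] by simp
  obtain DR where DR: "\<And>z. z \<in> space M \<Longrightarrow> (g z has_real_derivative DR z) (at_right (a z))"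
    using R by metis
  obtain DL where DL: "\<And>z. z \<in> space M \<Longrightarrow> (g z has_real_derivative DL z) (at_left (a z))"
    using L by metis
  have seq: "(\<lambda>n. (g z (a z + 1 / real (Suc n)) - g z (a z)) / (1 / real (Suc n))) \<longlonglongrightarrow> DR z"
    if "z \<in> space M" for z
  proof -
    have "filterlim (\<lambda>n. a z + 1 / real (Suc n)) (at_right (a z)) sequentially"
      unfolding filterlim_at
      using tendsto_add[OF tendsto_const[of "a z"] LIMSEQ_inverse_real_of_nat]
      by (auto simp: inverse_eq_divide)
    from filterlim_compose[OF DR[OF that, unfolded has_field_derivative_iff] this]
    show ?thesis by simp
  qed
  have seq': "(\<lambda>n. (g z (a z + - (1 / real (Suc n))) - g z (a z)) / (- (1 / real (Suc n)))) \<longlonglongrightarrow> DL z"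
    if "z \<in> space M" for z
  proof -
    have "filterlim (\<lambda>n. a z + - (1 / real (Suc n))) (at_left (a z)) sequentially"
      unfolding filterlim_at
      using tendsto_add[OF tendsto_const[of "a z"] tendsto_minus[OF LIMSEQ_inverse_real_of_nat]]
      by (auto simp: inverse_eq_divide)
    from filterlim_compose[OF DL[OF that, unfolded has_field_derivative_iff] this]
    show ?thesis by simp
  qed
  have mR: "DR \<in> borel_measurable M"
    by (rule borel_measurable_LIMSEQ_real[OF seq], assumption)
       (intro borel_measurable_divide borel_measurable_diff g g0 borel_measurable_const)
  have mL: "DL \<in> borel_measurable M"
    by (rule borel_measurable_LIMSEQ_real[OF seq'], assumption)
       (intro borel_measurable_divide borel_measurable_diff g g0 borel_measurable_const)
  have "(\<lambda>z. if DL z = DR z then DR z else (SOME D. False)) \<in> borel_measurable M"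
    using mR mL by measurable
  then show ?thesis
    using deriv_from_one_sided[OF DR DL] by (subst measurable_cong) auto
qed

lemma relu_tendsto: "(f \<longlongrightarrow> l) F \<Longrightarrow> ((\<lambda>y. relu (f y)) \<longlongrightarrow> relu l) F"
  unfolding relu_def by (intro tendsto_max tendsto_const)

text \<open>At a zero of \<open>g\<close>, positive homogeneity lets ReLU commute with division by y
  - x on the right; on the left the divisor is negative and ReLU becomes the map sending t to -relu
  (-t). Both maps are continuous, so the quotients converge.\<close>

lemma one_sided_derivative_relu:
  fixes g :: "real \<Rightarrow> real"
  assumes g: "(g has_real_derivative D) (at x within S)" and S: "S = {x<..} \<or> S = {..<x}"
  shows "\<exists>D. ((\<lambda>y. relu (g y)) has_real_derivative D) (at x within S)"
proof -
  have q: "((\<lambda>y. (g y - g x) / (y - x)) \<longlongrightarrow> D) (at x within S)"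
    using g by (simp add: has_field_derivative_iff)
  have c: "(g \<longlongrightarrow> g x) (at x within S)"
    using DERIV_continuous[OF g] by (simp add: continuous_within)
  consider "g x > 0" | "g x < 0" | "g x = 0" by linarith
  then show ?thesis
  proof cases
    case 1
    have "\<forall>\<^sub>F y in at x within S. (g y - g x) / (y - x) = (relu (g y) - relu (g x)) / (y - x)"
      using order_tendstoD(1)[OF c 1] by eventually_elim (use 1 in \<open>simp add: relu_def\<close>)
    from Lim_transform_eventually[OF q this] show ?thesis
      unfolding has_field_derivative_iff by blast
  next
    case 2
    have "\<forall>\<^sub>F y in at x within S. 0 = (relu (g y) - relu (g x)) / (y - x)"
      using order_tendstoD(2)[OF c 2] by eventually_elim (use 2 in \<open>simp add: relu_def\<close>)
    from Lim_transform_eventually[OF tendsto_const[of 0] this] show ?thesis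
      unfolding has_field_derivative_iff by blast
  next
    case 3
    show ?thesis using S
    proof
      assume S: "S = {x<..}"
      have "\<forall>\<^sub>F y in at x within S. relu ((g y - g x) / (y - x)) = (relu (g y) - relu (g x)) / (y - x)"
        unfolding eventually_at_filter S using 3
        by (intro always_eventually) (auto simp: relu_def max_def divide_le_0_iff zero_le_divide_iff)
      from Lim_transform_eventually[OF relu_tendsto[OF q] this] show ?thesis
        unfolding has_field_derivative_iff by blast
    next
      assume S: "S = {..<x}"
      have "\<forall>\<^sub>F y in at x within S. - relu (- ((g y - g x) / (y - x))) = (relu (g y) - relu (g x)) / (y - x)"
        unfolding eventually_at_filter S using 3
        by (intro always_eventually) (auto simp: relu_def max_def divide_le_0_iff zero_le_divide_iff)
      from Lim_transform_eventually[OF tendsto_minus[OF relu_tendsto[OF tendsto_minus[OF q]]] this]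
      show ?thesis unfolding has_field_derivative_iff by blast
    qed
  qed
qed

lemma has_derivative_weight:
  fixes w :: "'a \<Rightarrow> real"
  shows "((\<lambda>\<theta>. (w(e := \<theta>)) e') has_real_derivative (if e' = e then 1 else 0)) (at u within S)"
  by (cases "e' = e") simp_all

text \<open>Holds at every configuration, also at kinks where the two-sided derivative fails,
  because sums, products and ReLU all preserve one-sided differentiability.\<close>

lemma (in relu_network) V_one_sided_derivative:
  assumes S: "S = {w e<..} \<or> S = {..<w e}"
  shows "t \<in> insert inp Ls \<Longrightarrow> i < N t
    \<Longrightarrow> \<exists>D. ((\<lambda>\<theta>. V (w(e := \<theta>)) t i) has_real_derivative D) (at (w e) within S)"
proof (induction t arbitrary: i rule: layer_induct)
  case base
  show ?case unfolding inp(3) by (blast intro: DERIV_const)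
next
  case (layer t)
  let ?D = "\<lambda>f D. (f has_real_derivative D) (at (w e) within S)"
  have 1: "\<exists>D. ?D (\<lambda>\<theta>. b t * V (w(e := \<theta>)) (skip t) i) D"
  proof (cases "b t = 0")
    case False
    have "\<exists>D. ?D (\<lambda>\<theta>. V (w(e := \<theta>)) (skip t) i) D"
      using skip[OF layer.hyps False] layer.prems by (intro layer.IH) auto
    then obtain D where "?D (\<lambda>\<theta>. V (w(e := \<theta>)) (skip t) i) D" by blast
    from DERIV_cmult[OF this] show ?thesis by (rule exI)
  qed (auto intro: DERIV_const)
  have 2: "\<exists>D. ?D (\<lambda>\<theta>. (w(e := \<theta>)) (lab t s, i, j) * out (w(e := \<theta>)) s j) D"
    if s: "s \<in> src t" "j < N s" for s j
  proof -
    obtain D where D: "?D (\<lambda>\<theta>. V (w(e := \<theta>)) s j) D"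
      using layer.IH[OF src(1,2)[OF layer.hyps s(1)] s(2)] by blast
    obtain D' where D': "?D (\<lambda>\<theta>. out (w(e := \<theta>)) s j) D'"
    proof (cases "isrelu s")
      case True
      obtain D0 where "?D (\<lambda>\<theta>. relu (V (w(e := \<theta>)) s j)) D0"
        using one_sided_derivative_relu[OF D S] by blast
      from DERIV_cmult[OF this, of "sqrt 2"] show ?thesis
        using True that by (simp add: out_def act_def)
    next
      case False
      then show ?thesis using that D by (simp add: out_def act_def)
    qed
    from DERIV_mult[OF has_derivative_weight D'] show ?thesis by (rule exI)
  qed
  obtain D1 where D1: "?D (\<lambda>\<theta>. b t * V (w(e := \<theta>)) (skip t) i) D1" using 1 by blast
  define D2 where "D2 s j = (SOME D. ?D (\<lambda>\<theta>. (w(e := \<theta>)) (lab t s, i, j) * out (w(e := \<theta>)) s j) D)" for s j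
  have D2: "?D (\<lambda>\<theta>. (w(e := \<theta>)) (lab t s, i, j) * out (w(e := \<theta>)) s j) (D2 s j)"
    if "s \<in> src t" "j < N s" for s j
    unfolding D2_def by (rule someI_ex[OF 2[OF that]])
  have "?D (\<lambda>\<theta>. b t * V (w(e := \<theta>)) (skip t) i
      + (\<Sum>s\<in>src t. c t s * (\<Sum>j<N s. (w(e := \<theta>)) (lab t s, i, j) * out (w(e := \<theta>)) s j)))
      (D1 + (\<Sum>s\<in>src t. c t s * (\<Sum>j<N s. D2 s j)))"
    by (intro DERIV_add D1 DERIV_sum DERIV_cmult D2) simp_all
  then show ?case
    unfolding V_rec[OF layer.hyps layer.prems] by (rule exI)
qed

text \<open>Almost sure agreement with a measurable tangent would not give this, as
  \<open>weight_measure\<close> need not be complete; and the Bochner integral of a nonmeasurable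
  function is 0 by convention.\<close>

lemma (in relu_network) measurable_deriv_V:
  assumes "e \<in> E" "t \<in> insert inp Ls" "i < N t"
  shows "(\<lambda>w. deriv (\<lambda>\<theta>. V (w(e := \<theta>)) t i) (w e)) \<in> borel_measurable P"
proof (rule measurable_deriv_of_one_sided)
  fix q
  have "(\<lambda>w. \<lambda>e'\<in>E. if e' = e then w e + q else w e') \<in> P \<rightarrow>\<^sub>M P"
  proof (rule measurable_restrict_weights)
    fix e' assume "e' \<in> E"
    then show "(\<lambda>w. if e' = e then w e + q else w e') \<in> borel_measurable P"
      using measurable_weight[OF \<open>e' \<in> E\<close>] measurable_weight[OF assms(1)] by (cases "e' = e") auto
  qed
  from measurable_compose[OF this measurable_V[OF assms(2,3)]]
  show "(\<lambda>w. V (w(e := w e + q)) t i) \<in> borel_measurable P"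
  proof (rule measurable_cong[THEN iffD1, rotated])
    fix w assume "w \<in> space P"
    then have "(\<lambda>e'\<in>E. if e' = e then w e + q else w e') = w(e := w e + q)"
      using assms(1) by (auto simp: weight_measure_def space_PiM PiE_def extensional_def)
    then show "V (\<lambda>e'\<in>E. if e' = e then w e + q else w e') t i = V (w(e := w e + q)) t i" by simp
  qed
qed (rule V_one_sided_derivative[OF disjI1[OF refl] assms(2,3)]
  V_one_sided_derivative[OF disjI2[OF refl] assms(2,3)])+

section \<open>Exchange of one gate in law\<close>

context relu_network_edge
begin

lemma flip_sign_cases:
  assumes "\<tau> \<in> Ls" "\<eta> \<in> {..<N \<tau>} \<rightarrow>\<^sub>E {1, - 1}" "e \<in> E"
  shows "flip_sign \<tau> \<eta> e = 1 \<or> flip_sign \<tau> \<eta> e = - 1"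
proof -
  obtain k i j where e: "e = (k, i, j)" by (cases e)
  have 1: "\<eta> i = 1 \<or> \<eta> i = - 1" if "s \<in> src \<tau>" "k = lab \<tau> s" for s
    using assms that lab_E[of \<tau> s i j] e by (auto simp: PiE_iff)
  have 2: "\<eta> j = 1 \<or> \<eta> j = - 1" if "t \<in> Ls" "\<tau> \<in> src t" "k = lab t \<tau>" for t
    using assms that lab_E[of t \<tau> i j] e by (auto simp: PiE_iff)
  define p where "p = (if \<exists>s\<in>src \<tau>. k = lab \<tau> s then \<eta> i else 1)"
  define q where "q = (if \<exists>t\<in>Ls. \<tau> \<in> src t \<and> k = lab t \<tau> then \<eta> j else 1)"
  have "p = 1 \<or> p = - 1" using 1 by (auto simp: p_def)
  moreover have "q = 1 \<or> q = - 1" using 2 by (auto simp: q_def)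
  moreover have "flip_sign \<tau> \<eta> e = p * q" by (simp add: e flip_sign_def p_def q_def)
  ultimately show ?thesis by auto
qed

lemma measurable_flip: "flip \<tau> \<eta> \<in> P \<rightarrow>\<^sub>M P"
  unfolding flip_def
  by (intro measurable_restrict_weights borel_measurable_times borel_measurable_const measurable_weight)

lemma top_0: "top \<in> insert inp Ls" "0 < N top"
  using top by auto

lemma measurable_hyb_pair:
  assumes "t \<in> insert inp Ls" "i < N t"
  shows "(\<lambda>z. hyb n (fst z) (snd z) t i) \<in> borel_measurable (P \<Otimes>\<^sub>M P)"
  using assms measurable_compose[OF measurable_snd measurable_weight_lab[OF tk]]
  by (intro measurable_hyb measurable_fst) auto

lemma hyb_law_step:
  assumes \<psi>: "\<psi> \<in> borel_measurable borel"
  shows "(\<integral>\<^sup>+z. \<psi> (hyb (Suc n) (fst z) (snd z) top 0) \<partial>(P \<Otimes>\<^sub>M P))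
    = (\<integral>\<^sup>+z. \<psi> (hyb n (fst z) (snd z) top 0) \<partial>(P \<Otimes>\<^sub>M P))"
proof (cases "\<exists>\<tau>\<in>Ls. isrelu \<tau> \<and> rank \<tau> = n \<and> rank tk \<le> n")
  case False
  then have "hyb (Suc n) w G top 0 = hyb n w G top 0" for w G
    using top_0 by (intro hyb_Suc_trivial) (auto simp: not_le)
  then show ?thesis by simp
next
  case True
  then obtain \<tau> where \<tau>: "\<tau> \<in> Ls" "isrelu \<tau>" "rank \<tau> = n" "rank tk \<le> n" by auto
  interpret P: prob_space P by (rule prob_space_weight_measure)
  let ?M = "P \<Otimes>\<^sub>M P" and ?H = "{..<N \<tau>} \<rightarrow>\<^sub>E {1, - 1 :: real}"
  let ?\<phi> = "\<lambda>\<eta> (w, G). (flip \<tau> \<eta> w, flip \<tau> \<eta> G)"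
  have m\<phi>: "?\<phi> \<eta> \<in> ?M \<rightarrow>\<^sub>M ?M" for \<eta>
    using measurable_flip[of \<tau> \<eta>] by measurable
  have d\<phi>: "distr ?M ?M (?\<phi> \<eta>) = ?M" if "\<eta> \<in> ?H" for \<eta>
  proof -
    have d: "distr P P (flip \<tau> \<eta>) = P"
      using distr_flip_weights[OF finite_E, of "flip_sign \<tau> \<eta>"] flip_sign_cases[OF \<tau>(1) that]
      by (simp add: flip_def[abs_def])
    have "distr P P (flip \<tau> \<eta>) \<Otimes>\<^sub>M distr P P (flip \<tau> \<eta>) = distr ?M ?M (?\<phi> \<eta>)"
      using P.sigma_finite_measure_axioms by (intro pair_measure_distr measurable_flip) (simp add: d)
    then show ?thesis by (simp add: d)
  qed
  have inv: "flip_choice n \<tau> (?\<phi> \<eta> z) = flip_choice n \<tau> z" if "\<eta> \<in> ?H" for \<eta> z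
  proof (rule ext)
    fix i
    obtain w G where z: "z = (w, G)" by (cases z)
    show "flip_choice n \<tau> (?\<phi> \<eta> z) i = flip_choice n \<tau> z i"
    proof (cases "i < N \<tau>")
      case True
      then have "\<eta> i = 1 \<or> \<eta> i = - 1" using that by (auto simp: PiE_iff)
      then have "\<eta> i * \<eta> i = 1" by auto
      then have sg: "(\<eta> i * V w \<tau> i) * (\<eta> i * hyb n w G \<tau> i) = V w \<tau> i * hyb n w G \<tau> i"
        by (metis mult.assoc mult.left_commute mult_1)
      have "flip_choice n \<tau> (?\<phi> \<eta> z) i
          = (if (\<eta> i * V w \<tau> i) * (\<eta> i * hyb n w G \<tau> i) < 0 then - 1 else 1)"
        using True by (simp add: z flip_choice_def V_flip_same[OF \<tau>(1,2)] hyb_flip_same[OF \<tau>(1,2)])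
      then show ?thesis unfolding sg using True by (simp add: z flip_choice_def)
    qed (simp add: z flip_choice_def)
  qed
  have m\<sigma>: "{z \<in> space ?M. flip_choice n \<tau> z = \<eta>} \<in> sets ?M" if "\<eta> \<in> ?H" for \<eta>
  proof -
    have "flip_choice n \<tau> z = \<eta> \<longleftrightarrow>
        (\<forall>i\<in>{..<N \<tau>}. (V (fst z) \<tau> i * hyb n (fst z) (snd z) \<tau> i < 0) = (\<eta> i = - 1))" for z
    proof -
      have "flip_choice n \<tau> z \<in> extensional {..<N \<tau>}" "\<eta> \<in> extensional {..<N \<tau>}"
        using that by (auto simp: flip_choice_def PiE_def split: prod.split)
      then have "flip_choice n \<tau> z = \<eta> \<longleftrightarrow> (\<forall>i\<in>{..<N \<tau>}. flip_choice n \<tau> z i = \<eta> i)"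
        by (auto intro: extensionalityI)
      also have "\<dots> \<longleftrightarrow> (\<forall>i\<in>{..<N \<tau>}. (V (fst z) \<tau> i * hyb n (fst z) (snd z) \<tau> i < 0) = (\<eta> i = - 1))"
      proof (rule ball_cong[OF refl])
        fix i assume i: "i \<in> {..<N \<tau>}"
        then have "\<eta> i = 1 \<or> \<eta> i = - 1" using that by (auto simp: PiE_iff)
        then show "(flip_choice n \<tau> z i = \<eta> i) = ((V (fst z) \<tau> i * hyb n (fst z) (snd z) \<tau> i < 0) = (\<eta> i = - 1))"
          using i by (auto simp: flip_choice_def case_prod_unfold)
      qed
      finally show ?thesis .
    qed
    moreover have "{z \<in> space ?M. \<forall>i\<in>{..<N \<tau>}.
        (V (fst z) \<tau> i * hyb n (fst z) (snd z) \<tau> i < 0) = (\<eta> i = - 1)} \<in> sets ?M"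
    proof (rule sets.sets_Collect_finite_All[OF _ finite_lessThan])
      fix i assume "i \<in> {..<N \<tau>}"
      then have [measurable]: "(\<lambda>z. V (fst z) \<tau> i) \<in> borel_measurable ?M"
          "(\<lambda>z. hyb n (fst z) (snd z) \<tau> i) \<in> borel_measurable ?M"
        using \<tau>(1) measurable_compose[OF measurable_fst measurable_V[of \<tau> i]] measurable_hyb_pair[of \<tau> i]
        by auto
      show "{z \<in> space ?M. (V (fst z) \<tau> i * hyb n (fst z) (snd z) \<tau> i < 0) = (\<eta> i = - 1)} \<in> sets ?M"
        by measurable
    qed
    ultimately show ?thesis by simp
  qed
  \<comment> \<open>\<open>hyb_flip_choice\<close> is available only at good weights, so the change
    of variables starts from an almost sure equality.\<close>
  have "AE z in ?M. good (fst z)"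
    by (rule AE_distrD[OF measurable_fst]) (simp only: P.distr_pair_fst AE_good)
  then have "(\<integral>\<^sup>+z. \<psi> (hyb (Suc n) (fst z) (snd z) top 0) \<partial>?M)
      = (\<integral>\<^sup>+z. (\<lambda>z. \<psi> (hyb n (fst z) (snd z) top 0)) (?\<phi> (flip_choice n \<tau> z) z) \<partial>?M)"
  proof (intro nn_integral_cong_AE, eventually_elim)
    case (elim z)
    have "top \<noteq> \<tau>" using top \<tau> by auto
    then have "n < rank top" using top(4)[OF \<tau>(1)] \<tau>(3) by auto
    then show ?case
      using hyb_flip_choice[OF \<tau> \<open>good (fst z)\<close> top_0(1) _ top_0(2), of "snd z"] by (simp add: case_prod_unfold)
  qed
  also have "\<dots> = (\<integral>\<^sup>+z. \<psi> (hyb n (fst z) (snd z) top 0) \<partial>?M)"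
  proof (rule nn_integral_select_preserving[where M = ?M and H = ?H and \<sigma> = "flip_choice n \<tau>" and \<phi> = ?\<phi>
        and F = "\<lambda>z. \<psi> (hyb n (fst z) (snd z) top 0)", OF _ m\<sigma> _ m\<phi> d\<phi> inv])
    show "finite ?H" by (intro finite_PiE) auto
    show "flip_choice n \<tau> z \<in> ?H" for z by (auto simp: flip_choice_def PiE_iff split: prod.split)
    show "(\<lambda>z. \<psi> (hyb n (fst z) (snd z) top 0)) \<in> borel_measurable ?M"
      using measurable_compose[OF measurable_hyb_pair[OF top_0] \<psi>] .
  qed
  finally show ?thesis .
qed

lemma hyb_law:
  assumes \<psi>: "\<psi> \<in> borel_measurable borel"
  shows "(\<integral>\<^sup>+z. \<psi> (hyb n (fst z) (snd z) top 0) \<partial>(P \<Otimes>\<^sub>M P))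
    = (\<integral>\<^sup>+z. \<psi> (hyb 0 (fst z) (snd z) top 0) \<partial>(P \<Otimes>\<^sub>M P))"
  by (induction n) (simp_all add: hyb_law_step[OF \<psi>])

end

section \<open>Derivatives\<close>

lemma isCont_tendsto_nhds: "isCont f x \<Longrightarrow> (f \<longlongrightarrow> f x) (nhds x)"
  by (simp add: isCont_def tendsto_at_iff_tendsto_nhds)

context relu_network_edge
begin

definition edge_entries :: "(wlabel \<times> nat \<times> nat) set" where
  "edge_entries = {e \<in> E. fst e = lab tk sk}"

definition unit_weight :: "wlabel \<times> nat \<times> nat \<Rightarrow> weights" where
  "unit_weight e = (\<lambda>e'. if e' = e then 1 else 0)"

text \<open>The threshold exceeds the rank of every layer, so all gates are those of the
  network.\<close>

definition tangent :: "weights \<Rightarrow> weights \<Rightarrow> 'l \<Rightarrow> nat \<Rightarrow> real" where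
  "tangent = hyb (Suc (rank top))"

definition slope :: "weights \<Rightarrow> 'l \<Rightarrow> nat \<Rightarrow> real" where
  "slope w s j = (if \<not> isrelu s then 1 else if 0 < V w s j then sqrt 2 else 0)"

lemma finite_edge_entries: "finite edge_entries"
  using finite_E by (simp add: edge_entries_def)

lemma rank_le_top: "s \<in> Ls \<Longrightarrow> rank s \<le> rank top"
  using top(4)[of s] by (cases "s = top") auto

lemma tangent_inp: "tangent w G inp i = 0"
  by (simp add: tangent_def)

lemma tangent_rec: "t \<in> Ls \<Longrightarrow> tangent w G t i = b t * tangent w G (skip t) i
     + (\<Sum>s\<in>src t. c t s * (\<Sum>j<N s. (if t = tk \<and> s = sk then G (lab t s, i, j) else 0) * out w s j
         + w (lab t s, i, j) * (slope w s j * tangent w G s j)))"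
proof -
  assume t: "t \<in> Ls"
  have "gate (Suc (rank top)) w s j p = slope w s j * p" if "s \<in> src t" for s j p
    using src(1)[OF t that] inp(2) rank_le_top[of s] by (auto simp: gate_def slope_def)
  then show ?thesis
    unfolding tangent_def hyb_rec[OF t] by simp
qed

text \<open>With all gates fixed by \<open>V\<close> the recursion is linear in \<open>G\<close> and
  consults only the entries of the matrix k. Together with \<open>V_has_derivative\<close> this
  identifies the tangent at \<open>top\<close> with the pairing of Jacobian and direction.\<close>

lemma tangent_linear:
  "t \<in> insert inp Ls \<Longrightarrow> i < N t \<Longrightarrow>
    tangent w G t i = (\<Sum>e\<in>edge_entries. G e * tangent w (unit_weight e) t i)"
proof (induction t arbitrary: i rule: layer_induct)
  case base
  then show ?case by (simp add: tangent_inp)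
next
  case (layer t)
  let ?K = edge_entries
  let ?T = "\<lambda>G s j. (if t = tk \<and> s = sk then G (lab t s, i, j) else 0) * out w s j
         + w (lab t s, i, j) * (slope w s j * tangent w G s j)"
  have sk: "b t * tangent w G (skip t) i = (\<Sum>e\<in>?K. G e * (b t * tangent w (unit_weight e) (skip t) i))"
  proof (cases "b t = 0")
    case False
    then show ?thesis
      using layer.IH[of "skip t" i] skip[OF layer.hyps False] layer.prems
      by (simp add: sum_distrib_left mult.left_commute)
  qed simp
  have T: "?T G s j = (\<Sum>e\<in>?K. G e * ?T (unit_weight e) s j)" if s: "s \<in> src t" "j < N s" for s j
  proof -
    have IH: "tangent w G s j = (\<Sum>e\<in>?K. G e * tangent w (unit_weight e) s j)"
      using layer.IH[OF src(1,2)[OF layer.hyps s(1)] s(2)] .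
    have "(if t = tk \<and> s = sk then G (lab t s, i, j) else 0)
        = (\<Sum>e\<in>?K. G e * (if t = tk \<and> s = sk then unit_weight e (lab t s, i, j) else 0))"
    proof (cases "t = tk \<and> s = sk")
      case True
      then have "(lab t s, i, j) \<in> ?K"
        using lab_E[OF tk] layer.prems s by (auto simp: edge_entries_def)
      then show ?thesis
        using True finite_edge_entries by (simp add: unit_weight_def if_distrib[of "\<lambda>x. _ * x"] cong: if_cong)
    qed auto
    then have "?T G s j = (\<Sum>e\<in>?K. G e * (if t = tk \<and> s = sk then unit_weight e (lab t s, i, j) else 0)) * out w s j
        + w (lab t s, i, j) * (slope w s j * (\<Sum>e\<in>?K. G e * tangent w (unit_weight e) s j))"
      by (simp only: IH)
    also have "\<dots> = (\<Sum>e\<in>?K. G e * ?T (unit_weight e) s j)"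
      unfolding sum_distrib_right sum_distrib_left sum.distrib[symmetric]
      by (intro sum.cong refl) (simp add: algebra_simps)
    finally show ?thesis .
  qed
  have "(\<Sum>s\<in>src t. c t s * (\<Sum>j<N s. ?T G s j))
      = (\<Sum>s\<in>src t. c t s * (\<Sum>j<N s. \<Sum>e\<in>?K. G e * ?T (unit_weight e) s j))"
    using T by (intro sum.cong refl arg_cong[where f = "(*) _"]) auto
  also have "\<dots> = (\<Sum>s\<in>src t. \<Sum>e\<in>?K. c t s * (\<Sum>j<N s. G e * ?T (unit_weight e) s j))"
    by (subst sum.swap) (simp only: sum_distrib_left)
  also have "\<dots> = (\<Sum>e\<in>?K. \<Sum>s\<in>src t. c t s * (\<Sum>j<N s. G e * ?T (unit_weight e) s j))"
    by (rule sum.swap)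
  also have "\<dots> = (\<Sum>e\<in>?K. G e * (\<Sum>s\<in>src t. c t s * (\<Sum>j<N s. ?T (unit_weight e) s j)))"
    by (simp only: sum_distrib_left mult.left_commute)
  finally have "tangent w G t i = (\<Sum>e\<in>?K. G e * (b t * tangent w (unit_weight e) (skip t) i))
      + (\<Sum>e\<in>?K. G e * (\<Sum>s\<in>src t. c t s * (\<Sum>j<N s. ?T (unit_weight e) s j)))"
    unfolding tangent_rec[OF layer.hyps, of w G] sk by (simp only:)
  also have "\<dots> = (\<Sum>e\<in>?K. G e * tangent w (unit_weight e) t i)"
    unfolding sum.distrib[symmetric] distrib_left[symmetric]
    by (simp only: tangent_rec[OF layer.hyps])
  finally show ?case .
qed

text \<open>The second conjunct handles the kink. A ReLU unit with \<open>V = 0\<close> has only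
  silent ReLU sources; by induction they stay silent near \<open>w e\<close>, so its preactivation
  stays exactly 0. A unit with negative \<open>V\<close> stays silent by continuity. Hence the
  output of a silent unit is locally constant and differentiable with slope 0.\<close>

lemma V_has_derivative:
  assumes w: "good w" and e: "e \<in> edge_entries"
  shows "t \<in> insert inp Ls \<Longrightarrow>
     (\<forall>i<N t. ((\<lambda>\<theta>. V (w(e := \<theta>)) t i) has_real_derivative tangent w (unit_weight e) t i) (at (w e)))
   \<and> (isrelu t \<longrightarrow> (\<forall>i<N t. out w t i = 0 \<longrightarrow> (\<forall>\<^sub>F \<theta> in nhds (w e). out (w(e := \<theta>)) t i = 0)))"
proof (induction t rule: layer_induct)
  case base
  then show ?case by (simp add: inp tangent_inp)
next
  case (layer t)
  let ?D = "\<lambda>f D. (f has_real_derivative D) (at (w e))"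
  let ?\<delta> = "unit_weight e"
  have V_src: "?D (\<lambda>\<theta>. V (w(e := \<theta>)) s j) (tangent w ?\<delta> s j)"
    and dead_src: "isrelu s \<Longrightarrow> out w s j = 0 \<Longrightarrow> \<forall>\<^sub>F \<theta> in nhds (w e). out (w(e := \<theta>)) s j = 0"
    if "s \<in> src t" "j < N s" for s j
    using layer.IH[OF src(1,2)[OF layer.hyps that(1)]] that(2) by blast+
  have out_src: "?D (\<lambda>\<theta>. out (w(e := \<theta>)) s j) (slope w s j * tangent w ?\<delta> s j)"
    if s: "s \<in> src t" "j < N s" for s j
  proof (cases "isrelu s")
    case False
    then show ?thesis using V_src[OF s] by (simp add: out_def act_def slope_def)
  next
    case True
    show ?thesis
    proof (cases "out w s j = 0")
      case z: True
      then have sl: "slope w s j = 0" using True by (simp add: slope_def out_def act_eq_0_iff)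
      have "?D (\<lambda>\<theta>. 0) 0" by simp
      then show ?thesis
        unfolding sl mult_zero_left
        by (rule DERIV_cong_ev[THEN iffD1, rotated -1])
           (use dead_src[OF s True z] in \<open>auto elim: eventually_mono\<close>)
    next
      case nz: False
      then have pos: "V w s j > 0" using True by (auto simp: out_def act_eq_0_iff)
      have "((\<lambda>\<theta>. V (w(e := \<theta>)) s j) \<longlongrightarrow> V (w(e := w e)) s j) (nhds (w e))"
        by (rule isCont_tendsto_nhds[OF DERIV_isCont[OF V_src[OF s]]])
      from order_tendstoD(1)[OF this, of 0] pos
      have "\<forall>\<^sub>F \<theta> in nhds (w e). 0 < V (w(e := \<theta>)) s j" by simp
      then have ev: "\<forall>\<^sub>F \<theta> in nhds (w e). sqrt 2 * V (w(e := \<theta>)) s j = out (w(e := \<theta>)) s j"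
        by eventually_elim (simp add: out_def act_def relu_def True)
      have sl: "slope w s j = sqrt 2" using True pos by (simp add: slope_def)
      show ?thesis
        unfolding sl
        by (rule DERIV_cong_ev[THEN iffD1, OF refl ev refl DERIV_cmult[OF V_src[OF s]]])
    qed
  qed
  have V_t: "?D (\<lambda>\<theta>. V (w(e := \<theta>)) t i) (tangent w ?\<delta> t i)" if i: "i < N t" for i
  proof -
    have 1: "?D (\<lambda>\<theta>. b t * V (w(e := \<theta>)) (skip t) i) (b t * tangent w ?\<delta> (skip t) i)"
    proof (cases "b t = 0")
      case False
      have "?D (\<lambda>\<theta>. V (w(e := \<theta>)) (skip t) i) (tangent w ?\<delta> (skip t) i)"
        using layer.IH[OF insertI2 skip(2)[OF layer.hyps False]] skip(1,3)[OF layer.hyps False] i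
        by metis
      then show ?thesis by (rule DERIV_cmult)
    qed simp
    have 2: "?D (\<lambda>\<theta>. (w(e := \<theta>)) (lab t s, i, j) * out (w(e := \<theta>)) s j)
        ((if t = tk \<and> s = sk then ?\<delta> (lab t s, i, j) else 0) * out w s j
         + w (lab t s, i, j) * (slope w s j * tangent w ?\<delta> s j))" if s: "s \<in> src t" "j < N s" for s j
    proof -
      have "(if (lab t s, i, j) = e then 1 else 0) = (if t = tk \<and> s = sk then ?\<delta> (lab t s, i, j) else 0)"
        using e lab_inj[OF layer.hyps s(1) tk] by (auto simp: unit_weight_def edge_entries_def)
      then show ?thesis
        using DERIV_mult[OF has_derivative_weight out_src[OF s], of w e "(lab t s, i, j)"]
        by (simp add: mult.commute)
    qed
    have "?D (\<lambda>\<theta>. b t * V (w(e := \<theta>)) (skip t) i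
        + (\<Sum>s\<in>src t. c t s * (\<Sum>j<N s. (w(e := \<theta>)) (lab t s, i, j) * out (w(e := \<theta>)) s j)))
        (tangent w ?\<delta> t i)"
      unfolding tangent_rec[OF layer.hyps, of w ?\<delta>]
      by (intro DERIV_add 1 DERIV_sum DERIV_cmult 2) simp_all
    then show ?thesis
      unfolding V_rec[OF layer.hyps i] .
  qed
  moreover have "\<forall>\<^sub>F \<theta> in nhds (w e). out (w(e := \<theta>)) t i = 0"
    if r: "isrelu t" and i: "i < N t" and z: "out w t i = 0" for i
  proof (cases "V w t i = 0")
    case True
    have "\<forall>\<^sub>F \<theta> in nhds (w e). \<forall>s\<in>src t. \<forall>j\<in>{..<N s}. out (w(e := \<theta>)) s j = 0"
      using dead_src dead_unit[OF w layer.hyps r i True]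
      by (intro eventually_ball_finite finite_src layer.hyps ballI) auto
    then show ?thesis
    proof eventually_elim
      case (elim \<theta>)
      have "b t = 0" using skip(5)[OF layer.hyps] r by auto
      then have "V (w(e := \<theta>)) t i = 0"
        using elim unfolding V_rec[OF layer.hyps i] by simp
      then show ?case by (simp add: out_def act_eq_0_iff)
    qed
  next
    case False
    then have neg: "V w t i < 0" using z r by (simp add: out_def act_eq_0_iff)
    have "((\<lambda>\<theta>. V (w(e := \<theta>)) t i) \<longlongrightarrow> V (w(e := w e)) t i) (nhds (w e))"
      by (rule isCont_tendsto_nhds[OF DERIV_isCont[OF V_t[OF i]]])
    from order_tendstoD(2)[OF this, of 0] neg
    have "\<forall>\<^sub>F \<theta> in nhds (w e). V (w(e := \<theta>)) t i < 0" by simp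
    then show ?thesis by eventually_elim (simp add: out_def act_eq_0_iff r)
  qed
  ultimately show ?case by blast
qed

text \<open>The condition is spelled as membership in a set so as to match
  \<open>distr_mix_weights\<close> literally.\<close>

definition mix :: "weights \<Rightarrow> weights \<Rightarrow> weights" where
  "mix w G = (\<lambda>e\<in>E. if e \<in> {e. fst e = lab tk sk} then G e else w e)"

lemma mix_apply:
  assumes "t \<in> Ls" "s \<in> src t" "i < N t" "j < N s"
  shows "mix w G (lab t s, i, j) = (if t = tk \<and> s = sk then G else w) (lab t s, i, j)"
  using assms lab_inj[OF assms(1,2) tk] by (auto simp: mix_def lab_E)

text \<open>The entries of \<open>w\<close> at the matrix k multiply the tangent of
  \<open>sk\<close>, which is 0, and the output of \<open>sk\<close> depends only on layers below
  \<open>tk\<close>. So these entries are never consulted, and \<open>G\<close> can be written in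
  their place.\<close>

lemma hyb_mix:
  "t \<in> insert inp Ls \<Longrightarrow> i < N t \<Longrightarrow> hyb 0 w G t i = hyb 0 (mix w G) (mix w G) t i"
proof (induction t arbitrary: i rule: layer_induct)
  case (layer t)
  have "hyb 0 w G t i = 1 * hyb 0 (mix w G) (mix w G) t i"
  proof (rule hyb_eqI[OF layer.hyps])
    show "hyb 0 w G (skip t) i = 1 * hyb 0 (mix w G) (mix w G) (skip t) i" if "b t \<noteq> 0"
      using layer.IH[of "skip t" i] skip[OF layer.hyps that] layer.prems by auto
    fix s j assume s: "s \<in> src t" "j < N s"
    note IH = layer.IH[OF src(1,2)[OF layer.hyps s(1)] s(2)]
    have "out (mix w G) sk j = out w sk j" if "j < N sk"
    proof -
      have "V (mix w G) sk j = V w sk j"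
      proof (rule V_local[OF src(1)[OF tk] that])
        fix t' s' i' j' assume *: "t' \<in> Ls" "s' \<in> src t'" "rank t' \<le> rank sk" "i' < N t'" "j' < N s'"
        then have "t' \<noteq> tk" using src(2)[OF tk] by auto
        then show "mix w G (lab t' s', i', j') = w (lab t' s', i', j')"
          using mix_apply[OF *(1,2,4,5)] by simp
      qed
      then show ?thesis by (simp add: out_def)
    qed
    moreover have "hyb 0 w G sk j = 0" using hyb_below[OF src(1,2)[OF tk]] .
    ultimately show "(if t = tk \<and> s = sk then G (lab t s, i, j) else 0) * out w s j
          + w (lab t s, i, j) * gate 0 w s j (hyb 0 w G s j)
        = 1 * ((if t = tk \<and> s = sk then mix w G (lab t s, i, j) else 0) * out (mix w G) s j
          + mix w G (lab t s, i, j) * gate 0 (mix w G) s j (hyb 0 (mix w G) (mix w G) s j))"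
      unfolding mix_apply[OF layer.hyps s(1) layer.prems s(2)]
      using IH s by (auto simp: gate_def)
  qed
  then show ?case by simp
qed simp

text \<open>\<open>R\<close> is the reduced network in abstract form: the target of k reads the full
  network through k alone, and later layers keep what comes from rank \<open>tk\<close> on. The
  dropped terms carry zero tangent, and with threshold 0 every gate is \<open>act\<close>, so both
  obey the same recursion.\<close>

lemma hyb_reduced:
  assumes R_tk: "\<And>i. i < N tk \<Longrightarrow>
      R tk i = c tk sk * (\<Sum>j<N sk. w (lab tk sk, i, j) * act (isrelu sk) (V w sk j))"
    and R_above: "\<And>t i. t \<in> Ls \<Longrightarrow> rank tk < rank t \<Longrightarrow> i < N t \<Longrightarrow>
      R t i = (if rank tk \<le> rank (skip t) then b t * R (skip t) i else 0)
        + (\<Sum>s\<in>{s\<in>src t. rank tk \<le> rank s}.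
            c t s * (\<Sum>j<N s. w (lab t s, i, j) * act (isrelu s) (R s j)))"
  shows "t \<in> insert inp Ls \<Longrightarrow> rank tk \<le> rank t \<Longrightarrow> t \<noteq> inp \<Longrightarrow> i < N t \<Longrightarrow> hyb 0 w w t i = R t i"
proof (induction t arbitrary: i rule: layer_induct)
  case (layer t)
  show ?case
  proof (cases "t = tk")
    case True
    have below: "hyb 0 w w s j = 0" if "s \<in> src tk" for s j
      using hyb_below[OF src(1,2)[OF tk(1) that]] .
    have "b tk * hyb 0 w w (skip tk) i = 0"
      using hyb_below[of "skip tk"] skip[OF tk(1)] by (cases "b tk = 0") auto
    then have "hyb 0 w w tk i
        = (\<Sum>s\<in>src tk. c tk s * (\<Sum>j<N s. (if s = sk then w (lab tk s, i, j) else 0) * out w s j))"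
      unfolding hyb_rec[OF tk(1)] by (simp add: below cong: sum.cong)
    also have "\<dots> = (\<Sum>s\<in>src tk. if s = sk then c tk sk * (\<Sum>j<N sk. w (lab tk sk, i, j) * out w sk j) else 0)"
      by (intro sum.cong refl) simp
    also have "\<dots> = R tk i"
      using tk finite_src[OF tk(1)] layer.prems True by (simp add: R_tk out_def)
    finally show ?thesis using True by simp
  next
    case False
    then have "rank tk \<noteq> rank t"
      using rank_inj[OF tk(1) layer.hyps] by auto
    then have r: "rank tk < rank t" using layer.prems(1) by simp
    have "b t * hyb 0 w w (skip t) i = (if rank tk \<le> rank (skip t) then b t * R (skip t) i else 0)"
      using layer.IH[of "skip t" i] hyb_below[of "skip t" 0 w w i] skip[OF layer.hyps] layer.prems inp(1)
      by (cases "b t = 0") (auto simp: not_le)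
    moreover have "(\<Sum>s\<in>src t. c t s * (\<Sum>j<N s. w (lab t s, i, j) * gate 0 w s j (hyb 0 w w s j)))
        = (\<Sum>s\<in>{s\<in>src t. rank tk \<le> rank s}.
            c t s * (\<Sum>j<N s. w (lab t s, i, j) * act (isrelu s) (R s j)))"
    proof (rule sum.mono_neutral_cong_right[OF finite_src[OF layer.hyps]])
      show "\<forall>s\<in>src t - {s\<in>src t. rank tk \<le> rank s}.
          c t s * (\<Sum>j<N s. w (lab t s, i, j) * gate 0 w s j (hyb 0 w w s j)) = 0"
        using src(1)[OF layer.hyps] by (auto simp: hyb_below not_le)
      fix s assume s: "s \<in> {s\<in>src t. rank tk \<le> rank s}"
      have "gate 0 w s j (hyb 0 w w s j) = act (isrelu s) (R s j)" if "j < N s" for j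
      proof (cases "s = inp")
        case True
        then show ?thesis using s inp(5)[OF tk(1)] by auto
      next
        case False
        then show ?thesis
          using layer.IH[of s j] src(1,2)[OF layer.hyps, of s] s that
          by (auto simp: gate_def act_def relu_def)
      qed
      then show "c t s * (\<Sum>j<N s. w (lab t s, i, j) * gate 0 w s j (hyb 0 w w s j))
          = c t s * (\<Sum>j<N s. w (lab t s, i, j) * act (isrelu s) (R s j))" by simp
    qed auto
    ultimately show ?thesis
      unfolding hyb_rec[OF layer.hyps] R_above[OF layer.hyps r layer.prems(3)] using False by simp
  qed
qed simp

end

section \<open>Jacobian moments\<close>

theorem (in relu_network_edge) jacobian_moments:
  assumes R_tk: "\<And>w i. i < N tk \<Longrightarrow>
      R w tk i = c tk sk * (\<Sum>j<N sk. w (lab tk sk, i, j) * act (isrelu sk) (V w sk j))"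
    and R_above: "\<And>w t i. t \<in> Ls \<Longrightarrow> rank tk < rank t \<Longrightarrow> i < N t \<Longrightarrow>
      R w t i = (if rank tk \<le> rank (skip t) then b t * R w (skip t) i else 0)
        + (\<Sum>s\<in>{s\<in>src t. rank tk \<le> rank s}.
            c t s * (\<Sum>j<N s. w (lab t s, i, j) * act (isrelu s) (R w s j)))"
  shows "jacobian_moment_claims E (\<lambda>w. V w top 0) (\<lambda>w. R w top 0) (lab tk sk)"
proof -
  interpret P: prob_space P by (rule prob_space_weight_measure)
  define h where "h w = hyb 0 w w top 0" for w
  define J where "J w = (\<Sum>e\<in>edge_entries. (tangent w (unit_weight e) top 0)^2)" for w
  define jac where "jac = jac_fro_sq E (\<lambda>w. V w top 0) (lab tk sk)"
  have jac_eq: "jac w = (\<Sum>e\<in>edge_entries. (deriv (\<lambda>\<theta>. V (w(e := \<theta>)) top 0) (w e))^2)" for w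
    by (simp add: jac_def jac_fro_sq_def edge_entries_def)
  have R: "R w top 0 = h w" for w
    unfolding h_def using top_0 rank_le_top[OF tk(1)] inp(1) top(1)
    by (intro hyb_reduced[symmetric] R_tk R_above) auto
  have h_meas: "h \<in> borel_measurable P"
    unfolding h_def using measurable_weight_lab[OF tk] top_0
    by (intro measurable_hyb[where f = "\<lambda>w. w" and g = "\<lambda>w. w"]) auto
  have jac_meas: "jac \<in> borel_measurable P"
    unfolding jac_eq using measurable_deriv_V[OF _ top_0]
    by (intro borel_measurable_sum borel_measurable_power) (auto simp: edge_entries_def)
  have jac_AE: "AE w in P. jac w = J w"
    using AE_good
  proof eventually_elim
    case (elim w)
    have "deriv (\<lambda>\<theta>. V (w(e := \<theta>)) top 0) (w e) = tangent w (unit_weight e) top 0"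
      if "e \<in> edge_entries" for e
      using V_has_derivative[OF elim that top_0(1)] top_0(2) by (intro DERIV_imp_deriv) blast
    then show ?case by (simp add: jac_eq J_def)
  qed
  have law: "(\<integral>\<^sup>+w. \<integral>\<^sup>+G. \<psi> (\<Sum>e\<in>edge_entries. G e * tangent w (unit_weight e) top 0) \<partial>P \<partial>P)
      = (\<integral>\<^sup>+w. \<psi> (h w) \<partial>P)" if \<psi>: "\<psi> \<in> borel_measurable borel" for \<psi> :: "real \<Rightarrow> ennreal"
  proof -
    let ?mix = "\<lambda>(w, G). \<lambda>e\<in>E. if e \<in> {e. fst e = lab tk sk} then G e else w e"
    have mix: "?mix z = mix (fst z) (snd z)" for z
      by (cases z) (simp add: mix_def)
    have "(\<integral>\<^sup>+w. \<integral>\<^sup>+G. \<psi> (\<Sum>e\<in>edge_entries. G e * tangent w (unit_weight e) top 0) \<partial>P \<partial>P)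
        = (\<integral>\<^sup>+w. \<integral>\<^sup>+G. \<psi> (tangent w G top 0) \<partial>P \<partial>P)"
      by (simp only: tangent_linear[OF top_0, symmetric])
    also have "\<dots> = (\<integral>\<^sup>+z. \<psi> (tangent (fst z) (snd z) top 0) \<partial>(P \<Otimes>\<^sub>M P))"
      unfolding tangent_def using measurable_compose[OF measurable_hyb_pair[OF top_0] \<psi>]
      by (subst P.nn_integral_fst[symmetric]) simp_all
    also have "\<dots> = (\<integral>\<^sup>+z. \<psi> (hyb 0 (fst z) (snd z) top 0) \<partial>(P \<Otimes>\<^sub>M P))"
      unfolding tangent_def by (rule hyb_law[OF \<psi>])
    also have "\<dots> = (\<integral>\<^sup>+z. \<psi> (h (?mix z)) \<partial>(P \<Otimes>\<^sub>M P))"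
      unfolding mix h_def using hyb_mix[OF top_0] by simp
    also have "\<dots> = (\<integral>\<^sup>+w. \<psi> (h w) \<partial>distr (P \<Otimes>\<^sub>M P) P ?mix)"
      using measurable_compose[OF h_meas \<psi>]
      by (intro nn_integral_distr[symmetric] measurable_mix_weights) simp
    finally show ?thesis unfolding distr_mix_weights[OF finite_E] .
  qed
  have K: "edge_entries \<subseteq> E" by (auto simp: edge_entries_def)
  have "(\<integral>\<^sup>+w. ennreal (jac w) \<partial>P) = (\<integral>\<^sup>+w. ennreal (J w) \<partial>P)"
    using jac_AE by (intro nn_integral_cong_AE) (auto elim: eventually_mono)
  also have "\<dots> = (\<integral>\<^sup>+w. ennreal ((h w)^2) \<partial>P)"
    \<comment> \<open>For fixed \<open>w\<close> the squared norm is written back as a Gaussian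
      integral over the direction, the form to which \<open>law\<close> applies.\<close>
    unfolding J_def gaussian_linear_form_moments(1)[OF finite_E K, symmetric]
    by (rule law[of "\<lambda>y. ennreal (y^2)"]) measurable
  finally have m2: "(\<integral>\<^sup>+w. ennreal (jac w) \<partial>P) = (\<integral>\<^sup>+w. ennreal ((h w)^2) \<partial>P)" .
  have jac2_meas: "(\<lambda>w. ennreal ((jac w)^2)) \<in> borel_measurable P" using jac_meas by measurable
  have "3 * (\<integral>\<^sup>+w. ennreal ((jac w)^2) \<partial>P) = (\<integral>\<^sup>+w. 3 * ennreal ((jac w)^2) \<partial>P)"
    using jac2_meas by (rule nn_integral_cmult[symmetric])
  also have "\<dots> = (\<integral>\<^sup>+w. 3 * ennreal ((J w)^2) \<partial>P)"
    using jac_AE by (intro nn_integral_cong_AE) (auto elim: eventually_mono)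
  also have "\<dots> = (\<integral>\<^sup>+w. ennreal ((h w)^4) \<partial>P)"
    unfolding J_def gaussian_linear_form_moments(2)[OF finite_E K, symmetric]
    by (rule law[of "\<lambda>y. ennreal (y^4)"]) measurable
  finally have m4: "3 * (\<integral>\<^sup>+w. ennreal ((jac w)^2) \<partial>P) = (\<integral>\<^sup>+w. ennreal ((h w)^4) \<partial>P)" .
  have jac_nonneg: "0 \<le> jac w" for w unfolding jac_eq by (intro sum_nonneg) simp
  \<comment> \<open>Each Bochner integral is \<open>enn2real\<close> of the nonnegative one, which
    sends infinity to 0 on both sides alike, so the identity transfers irrespective of
    finiteness.\<close>
  have 1: "(\<integral>w. jac w \<partial>P) = (\<integral>w. (h w)^2 \<partial>P)"
    using jac_meas h_meas jac_nonneg by (subst (1 2) integral_eq_nn_integral) (auto simp: m2)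
  have "(\<integral>w. (h w)^4 \<partial>P) = enn2real (3 * (\<integral>\<^sup>+w. ennreal ((jac w)^2) \<partial>P))"
    unfolding m4 using h_meas by (subst integral_eq_nn_integral) auto
  also have "\<dots> = 3 * (\<integral>w. (jac w)^2 \<partial>P)"
    using jac_meas by (subst integral_eq_nn_integral) (auto simp: enn2real_mult)
  finally have 2: "(\<integral>w. (h w)^4 \<partial>P) = 3 * (\<integral>w. (jac w)^2 \<partial>P)" .
  have "0 \<le> (\<integral>w. (jac w)^2 \<partial>P)" by (intro integral_nonneg_AE) auto
  then show ?thesis
    unfolding jacobian_moment_claims_def R jac_def[symmetric] using 1 2 by simp
qed

section \<open>DenseNets\<close>

lemma finite_entries:
  assumes "finite K"
  shows "finite (entries K nr nc)"
proof -
  have "entries K nr nc = (SIGMA k:K. {..<nr k} \<times> {..<nc k})"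
    by (auto simp: entries_def)
  then show ?thesis using assms by simp
qed

text \<open>Each step of the recursion writes only a new index, so all layers can be read off the
  single table at \<open>L\<close>.\<close>

lemma dn_ys_stable: "h \<le> l \<Longrightarrow> dn_ys d nw \<alpha> x red w l h = dn_ys d nw \<alpha> x red w h h"
  by (induction l) (auto simp: le_Suc_eq)

lemma dn_ys_Suc:
  assumes "l < L" "dn_src red (Suc l) \<subseteq> {..l}"
  shows "dn_ys d nw \<alpha> x red w L (Suc l) i = sqrt (\<alpha> / (nw l * Suc l)) *
     (\<Sum>h\<in>dn_src red (Suc l). \<Sum>j<nw h.
        w (Wbr (Suc l) h, i, j) * (sqrt 2 * relu (dn_ys d nw \<alpha> x red w L h j)))"
proof -
  have "dn_ys d nw \<alpha> x red w l h = dn_ys d nw \<alpha> x red w L h" if "h \<in> dn_src red (Suc l)" for h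
    using that assms dn_ys_stable[of h l] dn_ys_stable[of h L] by (auto simp: subset_eq)
  moreover have "dn_ys d nw \<alpha> x red w L (Suc l) = dn_ys d nw \<alpha> x red w (Suc l) (Suc l)"
    using assms by (intro dn_ys_stable) simp
  ultimately show ?thesis by (simp del: of_nat_Suc)
qed

lemma dn_ys_reduced_below:
  assumes "h < lk" "h \<le> L"
  shows "dn_ys d nw \<alpha> x (Some (lk, hk)) w L h = dn_ys d nw \<alpha> x None w L h"
  using assms
proof (induction h rule: less_induct)
  case (less h)
  show ?case
  proof (cases h)
    case 0
    then show ?thesis using dn_ys_stable[of 0 L] by simp
  next
    case (Suc l)
    then have src: "dn_src (Some (lk, hk)) (Suc l) = {..<Suc l}" "dn_src None (Suc l) = {..<Suc l}"
      using less.prems by (auto simp: dn_src_def)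
    show ?thesis
      unfolding Suc using less Suc
      by (intro ext) (subst (1 2) dn_ys_Suc, auto simp: src)
  qed
qed

definition dn_size :: "nat \<Rightarrow> nat \<Rightarrow> (nat \<Rightarrow> nat) \<Rightarrow> nat \<Rightarrow> nat" where
  "dn_size d L nw t = (if t = 0 then d else if t = L + 2 then 1 else nw (t - 1))"

text \<open>A hidden layer t holds y^(t-1) and reads y^0, ..., y^(t-2), which are the layers 1, ...,
  t-1.\<close>

definition dn_pred :: "nat \<Rightarrow> nat \<Rightarrow> nat set" where
  "dn_pred L t = (if t = 1 then {0} else if t = L + 2 then {L + 1} else Suc ` {..<t - 1})"

definition dn_lab :: "nat \<Rightarrow> nat \<Rightarrow> nat \<Rightarrow> wlabel" where
  "dn_lab L t s = (if t = 1 then Win else if t = L + 2 then Wout else Wbr (t - 1) (s - 1))"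

text \<open>With l = t-1, the indices \<open>t - 2\<close> and \<open>t - 1\<close> are the l-1 and
  l of the DenseNet scaling.\<close>

definition dn_coeff :: "nat \<Rightarrow> (nat \<Rightarrow> nat) \<Rightarrow> real \<Rightarrow> nat \<Rightarrow> nat \<Rightarrow> real" where
  "dn_coeff L nw \<alpha> t s = (if t = 1 then 1 / sqrt (nw 0) else if t = L + 2 then 1 / sqrt (nw L)
     else sqrt (\<alpha> / (nw (t - 2) * (t - 1))))"

text \<open>Layer 0 is the input, layer l + 1 is y^l and layer L + 2 the output.\<close>

definition dn_val :: "nat \<Rightarrow> nat \<Rightarrow> (nat \<Rightarrow> nat) \<Rightarrow> real \<Rightarrow> (nat \<Rightarrow> real) \<Rightarrow> (nat \<times> nat) option
    \<Rightarrow> weights \<Rightarrow> nat \<Rightarrow> nat \<Rightarrow> real" where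
  "dn_val d L nw \<alpha> x red w t i = (if t = 0 then x i
     else if t = L + 2 then densenet d L nw \<alpha> x red w else dn_ys d nw \<alpha> x red w L (t - 1) i)"

lemma dn_val_1: "dn_val d L nw \<alpha> x red w 1 i
    = dn_coeff L nw \<alpha> 1 0 * (\<Sum>j<d. w (Win, i, j) * x j)"
  using dn_ys_stable[of 0 L] by (simp add: dn_val_def dn_coeff_def)

lemma dn_val_top: "dn_val d L nw \<alpha> x red w (L + 2) 0
    = dn_coeff L nw \<alpha> (L + 2) (L + 1) * (\<Sum>j<nw L. w (Wout, 0, j) * dn_val d L nw \<alpha> x red w (L + 1) j)"
  by (simp add: dn_val_def dn_coeff_def densenet_def)

lemma dn_val_hidden:
  assumes t: "2 \<le> t" "t \<le> L + 1" and S: "dn_src red (t - 1) = S" "S \<subseteq> {..<t - 1}"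
  shows "dn_val d L nw \<alpha> x red w t i = (\<Sum>s\<in>Suc ` S. dn_coeff L nw \<alpha> t s *
     (\<Sum>j<dn_size d L nw s. w (dn_lab L t s, i, j) * act (1 \<le> s \<and> s \<le> L) (dn_val d L nw \<alpha> x red w s j)))"
proof -
  obtain l where l: "t = Suc (Suc l)" using t by (metis add_2_eq_Suc le_Suc_ex)
  have "dn_src red (Suc l) \<subseteq> {..l}" using S l by auto
  from dn_ys_Suc[OF _ this, of L]
  have "dn_val d L nw \<alpha> x red w t i = sqrt (\<alpha> / (nw l * Suc l)) *
     (\<Sum>h\<in>S. \<Sum>j<nw h. w (Wbr (Suc l) h, i, j) * (sqrt 2 * relu (dn_ys d nw \<alpha> x red w L h j)))"
    using t S by (simp add: dn_val_def l del: of_nat_Suc of_nat_mult)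
  also have "\<dots> = (\<Sum>h\<in>S. dn_coeff L nw \<alpha> t (Suc h) *
     (\<Sum>j<dn_size d L nw (Suc h). w (dn_lab L t (Suc h), i, j) *
        act (1 \<le> Suc h \<and> Suc h \<le> L) (dn_val d L nw \<alpha> x red w (Suc h) j)))"
    unfolding sum_distrib_left[of _ _ S]
  proof (intro sum.cong refl)
    fix h assume "h \<in> S"
    then have "h \<le> l" using S l by auto
    then show "sqrt (\<alpha> / (nw l * Suc l)) * (\<Sum>j<nw h. w (Wbr (Suc l) h, i, j) * (sqrt 2 * relu (dn_ys d nw \<alpha> x red w L h j)))
      = dn_coeff L nw \<alpha> t (Suc h) *
     (\<Sum>j<dn_size d L nw (Suc h). w (dn_lab L t (Suc h), i, j) *
        act (1 \<le> Suc h \<and> Suc h \<le> L) (dn_val d L nw \<alpha> x red w (Suc h) j))"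
      using t by (simp add: l dn_coeff_def dn_size_def dn_lab_def dn_val_def act_def)
  qed
  also have "\<dots> = (\<Sum>s\<in>Suc ` S. dn_coeff L nw \<alpha> t s *
     (\<Sum>j<dn_size d L nw s. w (dn_lab L t s, i, j) * act (1 \<le> s \<and> s \<le> L) (dn_val d L nw \<alpha> x red w s j)))"
    by (simp add: sum.reindex)
  finally show ?thesis .
qed

lemma finite_dn_entries: "finite (dn_entries d L nw)"
proof -
  have "dn_labels L \<subseteq> {Win, Wout} \<union> (\<lambda>(l, h). Wbr l h) ` ({..L} \<times> {..L})"
    by (force simp: dn_labels_def)
  then have "finite (dn_labels L)" by (rule finite_subset) auto
  then show ?thesis unfolding dn_entries_def by (rule finite_entries)
qed

text \<open>There are no skip connections. y^L is read only by the final projection and hence counts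
  as linear. The only linear layer that a ReLU layer reads is the input, so it alone has to be
  robust.\<close>

lemma dn_network:
  assumes x: "(\<Sum>j<d. (x j)^2) = 1" and L: "1 \<le> L" and nw: "\<forall>l\<le>L. 0 < nw l" and \<alpha>: "0 < \<alpha>"
  shows "relu_network (dn_entries d L nw) {1..L + 2} 0 (L + 2) {0} (\<lambda>t. t) (dn_size d L nw)
     (dn_pred L) (dn_lab L) (dn_coeff L nw \<alpha>) (\<lambda>_. 0) (\<lambda>t. t) (\<lambda>t. 1 \<le> t \<and> t \<le> L) x
     (dn_val d L nw \<alpha> x None)"
proof
  show "\<exists>j<dn_size d L nw 0. x j \<noteq> 0"
  proof (rule ccontr)
    assume "\<not> ?thesis"
    then have "(\<Sum>j<d. (x j)^2) = 0" by (intro sum.neutral) (auto simp: dn_size_def)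
    then show False using x by simp
  qed
next
  fix t s assume t: "t \<in> {1..L + 2}" "s \<in> dn_pred L t"
  show "dn_coeff L nw \<alpha> t s \<noteq> 0"
    using t nw L \<alpha> by (auto simp: dn_coeff_def dn_pred_def split: if_splits)
  show "(dn_lab L t s, i, j) \<in> dn_entries d L nw \<longleftrightarrow> i < dn_size d L nw t \<and> j < dn_size d L nw s" for i j
    using t L
    by (auto simp: dn_entries_def entries_def dn_labels_def dn_rows_def dn_cols_def dn_lab_def dn_size_def
        dn_pred_def split: if_splits)
  fix t' s' assume "t' \<in> {1..L + 2}" "s' \<in> dn_pred L t'" "dn_lab L t s = dn_lab L t' s'"
  then show "t = t' \<and> s = s'"
    using t by (auto simp: dn_lab_def dn_pred_def split: if_splits)
next
  fix w t i assume t: "t \<in> {1..L + 2}" "i < dn_size d L nw t"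
  consider "t = 1" | "t = L + 2" | "2 \<le> t" "t \<le> L + 1" using t by force
  then show "dn_val d L nw \<alpha> x None w t i = 0 * dn_val d L nw \<alpha> x None w t i +
      (\<Sum>s\<in>dn_pred L t. dn_coeff L nw \<alpha> t s *
        (\<Sum>j<dn_size d L nw s. w (dn_lab L t s, i, j) * act (1 \<le> s \<and> s \<le> L) (dn_val d L nw \<alpha> x None w s j)))"
  proof cases
    case 1
    then show ?thesis
      unfolding 1 dn_val_1 by (simp add: dn_pred_def dn_size_def dn_lab_def act_def dn_val_def)
  next
    case 2
    then show ?thesis
      using t dn_val_top[of d L nw \<alpha> x None w] by (simp add: dn_pred_def dn_size_def dn_lab_def act_def)
  next
    case 3
    then show ?thesis
      using dn_val_hidden[OF 3, of None "{..<t - 1}"] by (simp add: dn_pred_def dn_src_def)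
  qed
qed (use x L finite_dn_entries in
  \<open>auto simp: dn_val_def dn_size_def dn_pred_def split: if_splits intro!: gr0I\<close>)

lemma dn_jacobian_moments:
  assumes x: "(\<Sum>j<d. (x j)^2) = 1" and L: "1 \<le> L" and nw: "\<forall>l\<le>L. 0 < nw l" and \<alpha>: "0 < \<alpha>"
    and k: "k \<in> dn_labels L"
  shows "jacobian_moment_claims (dn_entries d L nw) (densenet d L nw \<alpha> x None)
     (densenet d L nw \<alpha> x (dn_red k)) k"
proof -
  interpret net: relu_network "dn_entries d L nw" "{1..L + 2}" 0 "L + 2" "{0}" "\<lambda>t. t" "dn_size d L nw"
     "dn_pred L" "dn_lab L" "dn_coeff L nw \<alpha>" "\<lambda>_. 0" "\<lambda>t. t" "\<lambda>t. 1 \<le> t \<and> t \<le> L" x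
     "dn_val d L nw \<alpha> x None"
    by (rule dn_network[OF x L nw \<alpha>])
  let ?V = "dn_val d L nw \<alpha> x"
  \<comment> \<open>Isolates what depends on the matrix: its target reads only \<open>sk\<close>,
    with values of the full network, and \<open>src\<close> says that later hidden layers keep
    exactly the sources from \<open>tk\<close> on.\<close>
  have claim: "jacobian_moment_claims (dn_entries d L nw) (densenet d L nw \<alpha> x None)
     (densenet d L nw \<alpha> x red) (dn_lab L tk sk)"
    if tk: "tk \<in> {1..L + 2}" "sk \<in> dn_pred L tk"
      and R_tk: "\<And>w i. i < dn_size d L nw tk \<Longrightarrow> ?V red w tk i = dn_coeff L nw \<alpha> tk sk *
          (\<Sum>j<dn_size d L nw sk. w (dn_lab L tk sk, i, j) * act (1 \<le> sk \<and> sk \<le> L) (?V None w sk j))"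
      and src: "\<And>t. tk < t \<Longrightarrow> 2 \<le> t \<Longrightarrow> t \<le> L + 1 \<Longrightarrow> Suc ` dn_src red (t - 1) = {s \<in> dn_pred L t. tk \<le> s}"
    for tk sk red
  proof -
    interpret edge: relu_network_edge "dn_entries d L nw" "{1..L + 2}" 0 "L + 2" "{0}" "\<lambda>t. t" "dn_size d L nw"
       "dn_pred L" "dn_lab L" "dn_coeff L nw \<alpha>" "\<lambda>_. 0" "\<lambda>t. t" "\<lambda>t. 1 \<le> t \<and> t \<le> L" x
       "?V None" tk sk
      by unfold_locales (use tk in auto)
    have "?V red w t i = (if tk \<le> t then 0 * ?V red w t i else 0) +
        (\<Sum>s\<in>{s \<in> dn_pred L t. tk \<le> s}. dn_coeff L nw \<alpha> t s *
          (\<Sum>j<dn_size d L nw s. w (dn_lab L t s, i, j) * act (1 \<le> s \<and> s \<le> L) (?V red w s j)))"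
      if t: "t \<in> {1..L + 2}" "tk < t" "i < dn_size d L nw t" for w t i
    proof (cases "t = L + 2")
      case True
      then have "{s \<in> dn_pred L t. tk \<le> s} = {L + 1}" using t by (auto simp: dn_pred_def)
      then show ?thesis
        using True t dn_val_top[of d L nw \<alpha> x red w] by (simp add: dn_size_def dn_lab_def act_def)
    next
      case False
      then have t2: "2 \<le> t" "t \<le> L + 1" using t tk by auto
      have "dn_src red (t - 1) \<subseteq> {..<t - 1}"
      proof
        fix h assume "h \<in> dn_src red (t - 1)"
        then have "Suc h \<in> dn_pred L t" using src[OF t(2) t2] by auto
        then show "h \<in> {..<t - 1}" using t2 by (auto simp: dn_pred_def)
      qed
      from dn_val_hidden[OF t2 refl this, of d nw \<alpha> x w i]
      show ?thesis unfolding src[OF t(2) t2] by simp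
    qed
    from edge.jacobian_moments[of "?V red", OF R_tk this]
    show ?thesis by (simp add: dn_val_def)
  qed
  consider "k = Win" | "k = Wout" | lk hk where "k = Wbr lk hk" "1 \<le> lk" "lk \<le> L" "hk < lk"
    using k by (auto simp: dn_labels_def)
  then show ?thesis
  proof cases
    case 1
    have "jacobian_moment_claims (dn_entries d L nw) (densenet d L nw \<alpha> x None)
      (densenet d L nw \<alpha> x None) (dn_lab L 1 0)"
    proof (rule claim)
      show "?V None w 1 i = dn_coeff L nw \<alpha> 1 0 * (\<Sum>j<dn_size d L nw 0. w (dn_lab L 1 0, i, j) *
          act (1 \<le> (0::nat) \<and> (0::nat) \<le> L) (?V None w 0 j))" for w i
        unfolding dn_val_1 by (simp add: dn_size_def dn_lab_def act_def dn_val_def)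
    qed (use L in \<open>auto simp: dn_pred_def dn_src_def\<close>)
    then show ?thesis by (simp add: 1 dn_red_def dn_lab_def)
  next
    case 2
    have "jacobian_moment_claims (dn_entries d L nw) (densenet d L nw \<alpha> x None)
      (densenet d L nw \<alpha> x None) (dn_lab L (L + 2) (L + 1))"
    proof (rule claim)
      show "?V None w (L + 2) i = dn_coeff L nw \<alpha> (L + 2) (L + 1) * (\<Sum>j<dn_size d L nw (L + 1).
          w (dn_lab L (L + 2) (L + 1), i, j) * act (1 \<le> L + 1 \<and> L + 1 \<le> L) (?V None w (L + 1) j))"
        if "i < dn_size d L nw (L + 2)" for w i
        using that dn_val_top[of d L nw \<alpha> x None w] by (simp add: dn_size_def dn_lab_def act_def)
    qed (use L in \<open>auto simp: dn_pred_def\<close>)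
    then show ?thesis by (simp add: 2 dn_red_def dn_lab_def)
  next
    case 3
    have "jacobian_moment_claims (dn_entries d L nw) (densenet d L nw \<alpha> x None)
      (densenet d L nw \<alpha> x (Some (lk, hk))) (dn_lab L (Suc lk) (Suc hk))"
    proof (rule claim)
      show "Suc lk \<in> {1..L + 2}" using 3 by simp
      show "Suc hk \<in> dn_pred L (Suc lk)" using 3 by (auto simp: dn_pred_def)
      have "?V (Some (lk, hk)) w (Suc lk) i = (\<Sum>s\<in>Suc ` {hk}. dn_coeff L nw \<alpha> (Suc lk) s *
          (\<Sum>j<dn_size d L nw s. w (dn_lab L (Suc lk) s, i, j) *
             act (1 \<le> s \<and> s \<le> L) (?V (Some (lk, hk)) w s j)))" for w i
        using 3 by (intro dn_val_hidden) (auto simp: dn_src_def)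
      moreover have "?V (Some (lk, hk)) w (Suc hk) j = ?V None w (Suc hk) j" for w j
        using 3 dn_ys_reduced_below[of hk lk L] by (simp add: dn_val_def)
      ultimately show "?V (Some (lk, hk)) w (Suc lk) i = dn_coeff L nw \<alpha> (Suc lk) (Suc hk) *
          (\<Sum>j<dn_size d L nw (Suc hk). w (dn_lab L (Suc lk) (Suc hk), i, j) *
             act (1 \<le> Suc hk \<and> Suc hk \<le> L) (?V None w (Suc hk) j))" for w i
        by simp
      show "Suc ` dn_src (Some (lk, hk)) (t - 1) = {s \<in> dn_pred L t. Suc lk \<le> s}"
        if "Suc lk < t" "2 \<le> t" "t \<le> L + 1" for t
      proof -
        have "Suc ` {lk..<t - 1} = {s \<in> Suc ` {..<t - 1}. Suc lk \<le> s}"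
          by (auto simp: image_Suc_lessThan)
        then show ?thesis using that by (simp add: dn_src_def dn_pred_def)
      qed
    qed
    then show ?thesis using 3 by (simp add: dn_red_def dn_lab_def)
  qed
qed

section \<open>ResNets\<close>

lemma res_y_reduced_below:
  "l < lk \<Longrightarrow> res_y d m n nb \<alpha> x (Some lk) w l = res_y d m n nb \<alpha> x None w l"
  by (induction l) auto

text \<open>The layer read by W^{l,h}. For \<open>h = 1\<close> this is y^(l-1), named after the
  last matrix of the preceding block or after \<open>Win\<close>; the same name serves as source of
  the skip connection of block l.\<close>

definition res_prev :: "nat \<Rightarrow> nat \<Rightarrow> nat \<Rightarrow> wlabel" where
  "res_prev m l h = (if h = 1 then if l = 1 then Win else Wbr (l - 1) m else Wbr l (h - 1))"

text \<open>Every matrix of a ResNet feeds its own layer, so layers are named by labels; \<^const>\<open>None\<close> is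
  the input, and the last layer of a branch also receives the skip connection.\<close>

fun res_rank :: "nat \<Rightarrow> nat \<Rightarrow> wlabel option \<Rightarrow> nat" where
  "res_rank L m None = 0"
| "res_rank L m (Some Win) = 1"
| "res_rank L m (Some (Wbr l h)) = 1 + ((l - 1) * m + h)"
| "res_rank L m (Some Wout) = 2 + L * m"

fun res_size :: "nat \<Rightarrow> nat \<Rightarrow> nat \<Rightarrow> (nat \<Rightarrow> nat \<Rightarrow> nat) \<Rightarrow> wlabel option \<Rightarrow> nat" where
  "res_size d m n nb None = d"
| "res_size d m n nb (Some k) = res_rows m n nb k"

fun res_pred :: "nat \<Rightarrow> nat \<Rightarrow> wlabel option \<Rightarrow> wlabel option set" where
  "res_pred L m None = {}"
| "res_pred L m (Some Win) = {None}"
| "res_pred L m (Some (Wbr l h)) = {Some (res_prev m l h)}"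
| "res_pred L m (Some Wout) = {Some (Wbr L m)}"

text \<open>The factor of the whole branch is absorbed into its last matrix.\<close>

fun res_coeff :: "nat \<Rightarrow> nat \<Rightarrow> (nat \<Rightarrow> nat \<Rightarrow> nat) \<Rightarrow> (nat \<Rightarrow> real) \<Rightarrow> wlabel option \<Rightarrow> wlabel option \<Rightarrow> real" where
  "res_coeff m n nb \<alpha> (Some (Wbr l h)) s
     = (if h = m then sqrt (\<alpha> l) else 1) * (1 / sqrt (res_dim m n nb (l - 1) (h - 1)))"
| "res_coeff m n nb \<alpha> _ s = 1 / sqrt n"

fun res_id :: "nat \<Rightarrow> wlabel option \<Rightarrow> real" where
  "res_id m (Some (Wbr l h)) = (if h = m then 1 else 0)"
| "res_id m _ = 0"

fun res_skip :: "nat \<Rightarrow> wlabel option \<Rightarrow> wlabel option" where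
  "res_skip m (Some (Wbr l h)) = Some (res_prev m l 1)"
| "res_skip m t = t"

fun res_relu :: "nat \<Rightarrow> wlabel option \<Rightarrow> bool" where
  "res_relu m (Some (Wbr l h)) = (h \<noteq> m)"
| "res_relu m _ = False"

text \<open>\<open>Wbr l m\<close> stands for y^l, the branch output with the skip term already
  added, so that every layer has a single matrix.\<close>

fun res_val :: "nat \<Rightarrow> nat \<Rightarrow> nat \<Rightarrow> nat \<Rightarrow> (nat \<Rightarrow> nat \<Rightarrow> nat) \<Rightarrow> (nat \<Rightarrow> real) \<Rightarrow> (nat \<Rightarrow> real)
    \<Rightarrow> nat option \<Rightarrow> weights \<Rightarrow> wlabel option \<Rightarrow> nat \<Rightarrow> real" where
  "res_val d L m n nb \<alpha> x red w None i = x i"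
| "res_val d L m n nb \<alpha> x red w (Some Win) i = res_y d m n nb \<alpha> x red w 0 i"
| "res_val d L m n nb \<alpha> x red w (Some (Wbr l h)) i
     = (if h = m then res_y d m n nb \<alpha> x red w l i
        else res_br m n nb w l (res_y d m n nb \<alpha> x red w (l - 1)) h i)"
| "res_val d L m n nb \<alpha> x red w (Some Wout) i = resnet d L m n nb \<alpha> x red w"

lemma res_rank_prev:
  assumes "1 \<le> l" "1 \<le> h"
  shows "Suc (res_rank L m (Some (res_prev m l h))) = res_rank L m (Some (Wbr l h))"
proof (cases "h = 1 \<and> l \<noteq> 1")
  case True
  then have "l = Suc (Suc (l - 2))" using assms by auto
  then obtain l' where "l = Suc (Suc l')" by blast
  then show ?thesis using True by (simp add: res_prev_def)
qed (use assms in \<open>auto simp: res_prev_def\<close>)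

text \<open>The matrices form one chain along which ranks grow by exactly 1. Therefore a layer
  strictly above k has its only matrix source at or above k, and nothing but a skip term can bypass
  k.\<close>

lemma res_rank_pred:
  assumes "t \<in> Some ` res_labels L m" "s \<in> res_pred L m t" "1 \<le> L"
  shows "Suc (res_rank L m s) = res_rank L m t"
proof -
  obtain L' where "L = Suc L'" using assms(3) by (cases L) auto
  then show ?thesis using assms res_rank_prev by (auto simp: res_labels_def)
qed

lemma res_rank_less:
  fixes m :: nat
  assumes "1 \<le> l" "l < l'" "h \<le> m" "1 \<le> h'"
  shows "(l - 1) * m + h < (l' - 1) * m + h'"
proof -
  have "(l - 1) * m + h \<le> (l - 1) * m + m" using assms by simp
  also have "\<dots> = l * m" using assms by (cases l) auto
  also have "\<dots> \<le> (l' - 1) * m" using assms by (intro mult_le_mono1) simp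
  finally show ?thesis using assms by simp
qed

lemma res_rank_le:
  fixes m :: nat
  assumes "1 \<le> l" "l \<le> L" "h \<le> m"
  shows "(l - 1) * m + h \<le> L * m"
proof -
  have "(l - 1) * m + h \<le> (l - 1) * m + m" using assms by simp
  also have "\<dots> = l * m" using assms by (cases l) auto
  also have "\<dots> \<le> L * m" using assms by (intro mult_le_mono1)
  finally show ?thesis .
qed

lemma res_size_prev:
  assumes "1 \<le> l" "1 \<le> h" "h \<le> m"
  shows "res_size d m n nb (Some (res_prev m l h)) = res_dim m n nb (l - 1) (h - 1)"
  using assms by (auto simp: res_prev_def res_rows_def res_dim_def)

lemma res_act_prev:
  assumes "1 \<le> l" "1 \<le> h" "h \<le> m"
  shows "act (res_relu m (Some (res_prev m l h))) (res_val d L m n nb \<alpha> x red w (Some (res_prev m l h)) j)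
    = (if h = 1 then res_y d m n nb \<alpha> x red w (l - 1) j
       else sqrt 2 * relu (res_br m n nb w l (res_y d m n nb \<alpha> x red w (l - 1)) (h - 1) j))"
  using assms by (auto simp: res_prev_def act_def)

lemma res_val_skip:
  assumes "1 \<le> l"
  shows "res_val d L m n nb \<alpha> x red w (Some (res_prev m l 1)) i = res_y d m n nb \<alpha> x red w (l - 1) i"
  using assms by (auto simp: res_prev_def)

lemma res_val_branch:
  assumes "1 \<le> l" "1 \<le> h" "h \<le> m"
  shows "res_val d L m n nb \<alpha> x red w (Some (Wbr l h)) i
    = (if h = m \<and> red \<noteq> Some l then res_val d L m n nb \<alpha> x red w (Some (res_prev m l 1)) i else 0)
     + res_coeff m n nb \<alpha> (Some (Wbr l h)) (Some (res_prev m l h)) *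
       (\<Sum>j<res_size d m n nb (Some (res_prev m l h)). w (Wbr l h, i, j) *
          act (res_relu m (Some (res_prev m l h))) (res_val d L m n nb \<alpha> x red w (Some (res_prev m l h)) j))"
proof -
  obtain l' where l: "l = Suc l'" using assms by (cases l) auto
  obtain h' where h: "h = Suc h'" using assms by (cases h) auto
  show ?thesis
    unfolding res_act_prev[OF assms] res_size_prev[OF assms] res_val_skip[OF assms(1)]
    unfolding l h diff_Suc_1
    by (cases "Suc h' = m") auto
qed

lemma res_val_out: "res_val d L m n nb \<alpha> x red w (Some Wout) 0
    = res_coeff m n nb \<alpha> (Some Wout) (Some (Wbr L m)) *
      (\<Sum>j<n. w (Wout, 0, j) * res_val d L m n nb \<alpha> x red w (Some (Wbr L m)) j)"
  by (simp add: resnet_def)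

lemma finite_res_labels: "finite (res_labels L m)"
proof -
  have "res_labels L m \<subseteq> {Win, Wout} \<union> (\<lambda>(l, h). Wbr l h) ` ({..L} \<times> {..m})"
    by (force simp: res_labels_def)
  then show ?thesis by (rule finite_subset) auto
qed

lemma res_labels_cases:
  assumes "t \<in> Some ` res_labels L m"
  obtains "t = Some Win" | "t = Some Wout"
    | l h where "t = Some (Wbr l h)" "1 \<le> l" "l \<le> L" "1 \<le> h" "h \<le> m"
  using assms by (auto simp: res_labels_def)

lemma res_prev_in_labels:
  assumes "1 \<le> l" "l \<le> L" "1 \<le> h" "h \<le> m"
  shows "res_prev m l h \<in> res_labels L m"
  using assms by (auto simp: res_prev_def res_labels_def)

lemma res_rank_inj:
  assumes s: "s \<in> Some ` res_labels L m" and t: "t \<in> Some ` res_labels L m"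
    and eq: "res_rank L m s = res_rank L m t"
  shows "s = t"
proof -
  have bound: "res_rank L m (Some (Wbr l h)) < res_rank L m (Some Wout)"
    if "1 \<le> l" "l \<le> L" "h \<le> m" for l h
    using res_rank_le[OF that] by simp
  have inj: "l = l' \<and> h = h'"
    if "1 \<le> l" "1 \<le> h" "h \<le> m" "1 \<le> l'" "1 \<le> h'" "h' \<le> m"
      "res_rank L m (Some (Wbr l h)) = res_rank L m (Some (Wbr l' h'))" for l h l' h'
  proof -
    have "\<not> l < l'" using res_rank_less[of l l' h m h'] that by auto
    moreover have "\<not> l' < l" using res_rank_less[of l' l h' m h] that by auto
    ultimately have "l = l'" by simp
    then show ?thesis using that(7) by simp
  qed
  show ?thesis
  proof (rule res_labels_cases[OF s])
    assume "s = Some Win"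
    then show ?thesis using eq by - (rule res_labels_cases[OF t], auto)
  next
    assume s': "s = Some Wout"
    show ?thesis
    proof (rule res_labels_cases[OF t])
      fix l h assume "t = Some (Wbr l h)" "1 \<le> l" "l \<le> L" "h \<le> m"
      then show ?thesis using bound[of l h] eq s' by simp
    qed (use eq s' in auto)
  next
    fix l h assume s': "s = Some (Wbr l h)" "1 \<le> l" "l \<le> L" "1 \<le> h" "h \<le> m"
    show ?thesis
    proof (rule res_labels_cases[OF t])
      assume "t = Some Wout"
      then show ?thesis using bound[of l h] eq s' by simp
    next
      fix l' h' assume "t = Some (Wbr l' h')" "1 \<le> l'" "1 \<le> h'" "h' \<le> m"
      then show ?thesis using inj[of l h l' h'] eq s' by simp
    qed (use eq s' in auto)
  qed
qed

text \<open>Each y^l is robust: even if its branch dies, it inherits nonvanishing from y^(l-1)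
  through the skip connection, down to y^0, which reads the nonzero input. These are the linear
  layers from which the ReLU layers of a branch start.\<close>

lemma res_network:
  assumes x: "(\<Sum>j<d. (x j)^2) = 1" and L: "1 \<le> L" and m: "1 \<le> m" and n: "0 < n"
    and nb: "\<forall>l<L. \<forall>h\<in>{1..<m}. 0 < nb l h" and \<alpha>: "\<forall>l\<in>{1..L}. 0 < \<alpha> l"
  shows "relu_network (res_entries d L m n nb) (Some ` res_labels L m) None (Some Wout)
     ({None, Some Win} \<union> {Some (Wbr l m) | l. 1 \<le> l \<and> l \<le> L}) (res_rank L m) (res_size d m n nb)
     (res_pred L m) (\<lambda>t s. the t) (res_coeff m n nb \<alpha>) (res_id m) (res_skip m) (res_relu m) x
     (res_val d L m n nb \<alpha> x None)"
proof
  show "finite (res_entries d L m n nb)"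
    unfolding res_entries_def by (rule finite_entries[OF finite_res_labels])
  show "\<exists>j<res_size d m n nb None. x j \<noteq> 0"
  proof (rule ccontr)
    assume "\<not> ?thesis"
    then have "(\<Sum>j<d. (x j)^2) = 0" by (intro sum.neutral) auto
    then show False using x by simp
  qed
  show "Some Wout \<in> Some ` res_labels L m" by (simp add: res_labels_def)
  show "0 < res_size d m n nb (Some Wout)" by (simp add: res_rows_def)
next
  fix t assume t: "t \<in> Some ` res_labels L m"
  show "res_rank L m None < res_rank L m t"
    using t by (cases rule: res_labels_cases) auto
  show "res_rank L m t < res_rank L m (Some Wout)" if "t \<noteq> Some Wout"
    using t that res_rank_le[of _ L _ m] by (cases rule: res_labels_cases) (auto simp: less_Suc_eq_le)
  show "finite (res_pred L m t)"
    using t by (cases rule: res_labels_cases) auto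
  show "s = t" if "s \<in> Some ` res_labels L m" "res_rank L m s = res_rank L m t" for s
    using res_rank_inj[OF that(1) t that(2)] .
  show "res_skip m t \<in> Some ` res_labels L m" "res_rank L m (res_skip m t) < res_rank L m t"
    "res_size d m n nb (res_skip m t) = res_size d m n nb t" "\<not> res_relu m (res_skip m t)" "\<not> res_relu m t"
    if b: "res_id m t \<noteq> 0"
  proof -
    obtain l where l: "t = Some (Wbr l m)" "1 \<le> l" "l \<le> L"
      using t b by (cases rule: res_labels_cases) (auto split: if_splits)
    show "res_skip m t \<in> Some ` res_labels L m"
      using l m res_prev_in_labels[of l L 1 m] by simp
    show "res_rank L m (res_skip m t) < res_rank L m t"
      using l m res_rank_prev[of l 1 L m] by simp
    show "res_size d m n nb (res_skip m t) = res_size d m n nb t"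
      using l m by (auto simp: res_prev_def res_rows_def res_dim_def)
    show "\<not> res_relu m (res_skip m t)" "\<not> res_relu m t"
      using l by (auto simp: res_prev_def)
  qed
  fix s assume s: "s \<in> res_pred L m t"
  show "s \<in> insert None (Some ` res_labels L m)"
    using t
  proof (cases rule: res_labels_cases)
    case (3 l h)
    then show ?thesis using s res_prev_in_labels[of l L h m] by simp
  qed (use s L m in \<open>auto simp: res_labels_def\<close>)
  show "res_rank L m s < res_rank L m t"
    using res_rank_pred[OF t s L] by simp
  show "res_coeff m n nb \<alpha> t s \<noteq> 0"
    using t
  proof (cases rule: res_labels_cases)
    case (3 l h)
    have "0 < nb (l - 1) (h - 1)" if "h \<noteq> 1"
    proof (rule nb[rule_format])
      show "l - 1 < L" using 3 by arith
      show "h - 1 \<in> {1..<m}" using 3 that by auto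
    qed
    then have "0 < res_dim m n nb (l - 1) (h - 1)"
      using 3 n by (auto simp: res_dim_def)
    moreover have "0 < \<alpha> l" using 3 \<alpha> by simp
    ultimately show ?thesis using 3 by simp
  qed (use n in auto)
  show "(the t, i, j) \<in> res_entries d L m n nb \<longleftrightarrow> i < res_size d m n nb t \<and> j < res_size d m n nb s" for i j
    using t
  proof (cases rule: res_labels_cases)
    case (3 l h)
    then show ?thesis
      using s res_size_prev[of l h m d n nb]
      by (auto simp: res_entries_def entries_def res_labels_def res_cols_def res_rows_def)
  qed (use s L in \<open>auto simp: res_entries_def entries_def res_labels_def res_cols_def res_rows_def res_dim_def\<close>)
  show "t = t' \<and> s = s'"
    if "t' \<in> Some ` res_labels L m" "s' \<in> res_pred L m t'" "the t = the t'" for t' s'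
  proof -
    have tt: "t = t'" using t that by auto
    show ?thesis using t
      by (cases rule: res_labels_cases) (use s that(2) tt in auto)
  qed
  show "res_relu m s \<or> s \<in> {None, Some Win} \<union> {Some (Wbr l m) |l. 1 \<le> l \<and> l \<le> L}" if "res_relu m t"
    using t that s by (cases rule: res_labels_cases) (auto simp: res_prev_def)
next
  fix t assume t: "t \<in> {None, Some Win} \<union> {Some (Wbr l m) |l. 1 \<le> l \<and> l \<le> L}"
  have "0 < d" using x by (cases d) auto
  then show "0 < res_size d m n nb t \<and> \<not> res_relu m t"
    using t n by (auto simp: res_rows_def res_dim_def)
  show "t = None \<or> t \<in> Some ` res_labels L m \<and>
      (res_id m t \<noteq> 0 \<and> res_skip m t \<in> {None, Some Win} \<union> {Some (Wbr l m) |l. 1 \<le> l \<and> l \<le> L}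
       \<or> ({None, Some Win} \<union> {Some (Wbr l m) |l. 1 \<le> l \<and> l \<le> L}) \<inter> res_pred L m t \<noteq> {})"
    (is "_ \<or> _ \<and> ?Q")
  proof -
    consider "t = None" | "t = Some Win" | l where "t = Some (Wbr l m)" "1 \<le> l" "l \<le> L"
      using t by auto
    then show ?thesis
    proof cases
      case (3 l)
      have "Some (res_prev m l 1) \<in> {None, Some Win} \<union> {Some (Wbr l m) |l. 1 \<le> l \<and> l \<le> L}"
        using 3 by (cases "l = 1") (auto simp: res_prev_def)
      then show ?thesis using 3 m by (simp add: res_labels_def)
    qed (auto simp: res_labels_def)
  qed
next
  fix w t i assume t: "t \<in> Some ` res_labels L m" "i < res_size d m n nb t"
  show "res_val d L m n nb \<alpha> x None w t i = res_id m t * res_val d L m n nb \<alpha> x None w (res_skip m t) i +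
      (\<Sum>s\<in>res_pred L m t. res_coeff m n nb \<alpha> t s *
        (\<Sum>j<res_size d m n nb s. w (the t, i, j) * act (res_relu m s) (res_val d L m n nb \<alpha> x None w s j)))"
    using t(1)
  proof (cases rule: res_labels_cases)
    case 1
    then show ?thesis by (simp add: act_def)
  next
    case 2
    then show ?thesis
      using t res_val_out[of d L m n nb \<alpha> x None w] by (simp add: act_def res_rows_def res_dim_def)
  next
    case (3 l h)
    show ?thesis
      unfolding 3 res_val_branch[OF 3(2,4,5)] by (simp only: res_id.simps res_skip.simps res_pred.simps
        option.sel sum.insert finite.emptyI empty_iff) simp
  qed
qed (auto simp: finite_res_labels)

lemma res_jacobian_moments:
  assumes x: "(\<Sum>j<d. (x j)^2) = 1" and L: "1 \<le> L" and m: "1 \<le> m" and n: "0 < n"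
    and nb: "\<forall>l<L. \<forall>h\<in>{1..<m}. 0 < nb l h" and \<alpha>: "\<forall>l\<in>{1..L}. 0 < \<alpha> l"
    and k: "k \<in> res_labels L m"
  shows "jacobian_moment_claims (res_entries d L m n nb) (resnet d L m n nb \<alpha> x None)
     (resnet d L m n nb \<alpha> x (res_red k)) k"
proof -
  let ?V = "res_val d L m n nb \<alpha> x"
  let ?c = "res_coeff m n nb \<alpha>" and ?N = "res_size d m n nb" and ?rank = "res_rank L m"
  have tk: "Some k \<in> Some ` res_labels L m" using k by simp
  obtain sk where sk: "sk \<in> res_pred L m (Some k)"
    using tk by (rule res_labels_cases) auto
  interpret net: relu_network "res_entries d L m n nb" "Some ` res_labels L m" None "Some Wout"
     "{None, Some Win} \<union> {Some (Wbr l m) | l. 1 \<le> l \<and> l \<le> L}" ?rank ?N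
     "res_pred L m" "\<lambda>t s. the t" ?c "res_id m" "res_skip m" "res_relu m" x "?V None"
    by (rule res_network[OF x L m n nb \<alpha>])
  interpret edge: relu_network_edge "res_entries d L m n nb" "Some ` res_labels L m" None "Some Wout"
     "{None, Some Win} \<union> {Some (Wbr l m) | l. 1 \<le> l \<and> l \<le> L}" ?rank ?N
     "res_pred L m" "\<lambda>t s. the t" ?c "res_id m" "res_skip m" "res_relu m" x "?V None" "Some k" sk
    by unfold_locales (use tk sk in auto)
  have R_tk: "?V (res_red k) w (Some k) i
      = ?c (Some k) sk * (\<Sum>j<?N sk. w (the (Some k), i, j) * act (res_relu m sk) (?V None w sk j))"
    if i: "i < ?N (Some k)" for w i
    using tk
  proof (cases rule: res_labels_cases)
    case 1
    then show ?thesis using sk by (simp add: act_def)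
  next
    case 2
    then show ?thesis
      using i sk res_val_out[of d L m n nb \<alpha> x None w]
      by (simp add: act_def res_rows_def res_dim_def res_red_def)
  next
    case (3 l h)
    have sk': "sk = Some (res_prev m l h)" using 3 sk by simp
    have "res_y d m n nb \<alpha> x (Some l) w (l - 1) = res_y d m n nb \<alpha> x None w (l - 1)"
      using 3 by (intro res_y_reduced_below) simp
    then have "act (res_relu m sk) (?V (Some l) w sk j) = act (res_relu m sk) (?V None w sk j)" for j
      unfolding sk' res_act_prev[OF 3(2,4,5)] by simp
    then show ?thesis
      using res_val_branch[OF 3(2,4,5), of d L n nb \<alpha> x "Some l" w i] 3(1)
      by (simp only: sk' res_red_def option.inject wlabel.case option.sel) simp
  qed
  \<comment> \<open>Matches the two descriptions of the reduction. Among the skip terms added above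
    k, the one of block l starts below k exactly when k is a branch matrix of that block, as y^(l-1)
    ranks just below W^{l,1}.\<close>
  have skip_iff: "res_red k \<noteq> Some l \<longleftrightarrow> ?rank (Some k) \<le> ?rank (Some (res_prev m l 1))"
    if l: "1 \<le> l" "l \<le> L" and r: "?rank (Some k) < ?rank (Some (Wbr l m))" for l
  proof -
    have prev: "?rank (Some (res_prev m l 1)) = 1 + (l - 1) * m"
      using res_rank_prev[OF l(1), of 1 L m] by simp
    show ?thesis using tk
    proof (cases rule: res_labels_cases)
      case 1
      then show ?thesis using prev by (simp add: res_red_def)
    next
      case 2
      then show ?thesis using r res_rank_le[OF l order.refl, of m] by simp
    next
      case (3 lk hk)
      show ?thesis
      proof (cases l lk rule: linorder_cases)
        case less
        then show ?thesis using r 3 res_rank_less[OF l(1) less, of m m hk] by simp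
      next
        case equal
        then show ?thesis using 3 prev by (simp add: res_red_def)
      next
        case greater
        then show ?thesis using 3 prev res_rank_less[OF 3(2) greater 3(5), of 1] by (simp add: res_red_def)
      qed
    qed
  qed
  have R_above: "?V (res_red k) w t i
      = (if ?rank (Some k) \<le> ?rank (res_skip m t) then res_id m t * ?V (res_red k) w (res_skip m t) i else 0)
      + (\<Sum>s\<in>{s \<in> res_pred L m t. ?rank (Some k) \<le> ?rank s}. ?c t s *
          (\<Sum>j<?N s. w (the t, i, j) * act (res_relu m s) (?V (res_red k) w s j)))"
    if t: "t \<in> Some ` res_labels L m" "?rank (Some k) < ?rank t" and i: "i < ?N t" for w t i
  proof -
    \<comment> \<open>The source has rank one less than \<open>t\<close>, hence at least the rank of
      k, so no matrix connection is dropped.\<close>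
    have src: "{s \<in> res_pred L m t. ?rank (Some k) \<le> ?rank s} = res_pred L m t"
      using res_rank_pred[OF t(1) _ L] t(2) by fastforce
    show ?thesis
      using t(1)
    proof (cases rule: res_labels_cases)
      case 1
      then show ?thesis using t(2) net.inp(5)[OF tk] by simp
    next
      case 2
      then show ?thesis
        unfolding src using i res_val_out[of d L m n nb \<alpha> x "res_red k" w]
        by (simp add: act_def res_rows_def res_dim_def)
    next
      case (3 l h)
      have "(if h = m \<and> res_red k \<noteq> Some l then ?V (res_red k) w (Some (res_prev m l 1)) i else 0)
        = (if ?rank (Some k) \<le> ?rank (res_skip m t) then res_id m t * ?V (res_red k) w (res_skip m t) i else 0)"
        using 3 skip_iff[of l] t(2) by (cases "h = m") auto
      then show ?thesis
        unfolding src using res_val_branch[OF 3(2,4,5), of d L n nb \<alpha> x "res_red k" w i] 3(1) by simp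
    qed
  qed
  from edge.jacobian_moments[of "?V (res_red k)", OF R_tk R_above]
  show ?thesis by simp
qed

theorem theorem2:
  fixes x :: "nat \<Rightarrow> real" and d :: nat
  assumes unit: "(\<Sum>j<d. (x j)^2) = 1"
  shows
    "(\<forall>L m n nb \<alpha> k.
        1 \<le> L \<and> 1 \<le> m \<and> 0 < n \<and> (\<forall>l<L. \<forall>h\<in>{1..<m}. 0 < nb l h)
        \<and> (\<forall>l\<in>{1..L}. 0 < \<alpha> l) \<and> k \<in> res_labels L m
        \<longrightarrow> jacobian_moment_claims (res_entries d L m n nb)
              (resnet d L m n nb \<alpha> x None) (resnet d L m n nb \<alpha> x (res_red k)) k)
   \<and> (\<forall>L nw \<alpha> k.
        1 \<le> L \<and> (\<forall>l\<le>L. 0 < nw l) \<and> 0 < \<alpha> \<and> k \<in> dn_labels L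
        \<longrightarrow> jacobian_moment_claims (dn_entries d L nw)
              (densenet d L nw \<alpha> x None) (densenet d L nw \<alpha> x (dn_red k)) k)"
  by (intro conjI allI impI; elim conjE)
     (rule res_jacobian_moments[OF unit] dn_jacobian_moments[OF unit]; assumption)+

end
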